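(* Let $n,T\in\mathbb N$ with $4\le T\le\binom n2$. Consider any streaming algorithm with a constant number of passes in the VArand model that takes as input a graph $G=(V,E)$ with $|V|=\Theta(n)$ together with a coloring $f:V\to[C]$, and that determines with probability at least $2/3$ whether the number of monochromatic edges of $G$ is $0$ or $\Omega(T)$ (under the promise that one of the two holds). Any such algorithm requires $\Omega\!\left(\frac{n}{T^2}\right)$ bits of space.
   Context: An edge $(u,v)$ is monochromatic if $f(u)=f(v)$. VArand model: the vertices are revealed one at a time, in an order chosen uniformly at random among all permutations of $V$. When a vertex $v$ is revealed, its color $f(v)$ is revealed, and then all edges between $v$ and previously revealed vertices are revealed one by one. Colors of earlier vertices are not revealed again. In a multi-pass algorithm, each pass reads the stream in this format. *)

theory Defs
  imports "HOL-Probability.Probability"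
begin

text \<open>Stream tokens of the VArand model: a vertex together with its colour,
  and an edge between the newly revealed vertex and an earlier one.\<close>
datatype token = VTok nat nat | ETok nat nat

definition is_graph :: "nat \<Rightarrow> nat set set \<Rightarrow> bool" where
  "is_graph N E \<longleftrightarrow> (\<forall>e\<in>E. e \<subseteq> {0..<N} \<and> card e = 2)"

definition mono_edges :: "nat set set \<Rightarrow> (nat \<Rightarrow> nat) \<Rightarrow> nat" where
  "mono_edges E f = card {e \<in> E. \<exists>u v. e = {u, v} \<and> f u = f v}"

definition orders :: "nat \<Rightarrow> nat list set" where
  "orders N = {xs. distinct xs \<and> set xs = {0..<N}}"

definition va_stream :: "nat set set \<Rightarrow> (nat \<Rightarrow> nat) \<Rightarrow> nat list \<Rightarrow> token list" where
  "va_stream E f ps =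
     concat (map (\<lambda>i. VTok (ps ! i) (f (ps ! i)) #
        map (\<lambda>u. ETok (ps ! i) u) (filter (\<lambda>u. {ps ! i, u} \<in> E) (take i ps)))
       [0..<length ps])"

text \<open>A p-pass streaming algorithm with random seed r (drawn from a pmf R):
  initial state init r, transition step r j q t in pass j, output out r q.
  The same stream (same random order) is read in every pass.\<close>
definition run_alg :: "nat \<Rightarrow> (nat \<Rightarrow> nat) \<Rightarrow> (nat \<Rightarrow> nat \<Rightarrow> nat \<Rightarrow> token \<Rightarrow> nat)
    \<Rightarrow> (nat \<Rightarrow> nat \<Rightarrow> bool) \<Rightarrow> nat \<Rightarrow> token list \<Rightarrow> bool" where
  "run_alg p init step out r xs =
     out r (foldl (\<lambda>q j. foldl (step r j) q xs) (init r) [0..<p])"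

definition uses_space :: "nat \<Rightarrow> (nat \<Rightarrow> nat) \<Rightarrow> (nat \<Rightarrow> nat \<Rightarrow> nat \<Rightarrow> token \<Rightarrow> nat) \<Rightarrow> bool" where
  "uses_space s init step \<longleftrightarrow>
     (\<forall>r. init r < 2 ^ s) \<and> (\<forall>r j q t. q < 2 ^ s \<longrightarrow> step r j q t < 2 ^ s)"

definition prob_answer :: "nat \<Rightarrow> nat pmf \<Rightarrow> (nat \<Rightarrow> nat) \<Rightarrow> (nat \<Rightarrow> nat \<Rightarrow> nat \<Rightarrow> token \<Rightarrow> nat)
    \<Rightarrow> (nat \<Rightarrow> nat \<Rightarrow> bool) \<Rightarrow> nat \<Rightarrow> nat set set \<Rightarrow> (nat \<Rightarrow> nat) \<Rightarrow> bool \<Rightarrow> real" where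
  "prob_answer p R init step out N E f b =
     measure_pmf.prob (pair_pmf (pmf_of_set (orders N)) R)
       {(ps, r). run_alg p init step out r (va_stream E f ps) = b}"

definition solves :: "nat \<Rightarrow> nat pmf \<Rightarrow> (nat \<Rightarrow> nat) \<Rightarrow> (nat \<Rightarrow> nat \<Rightarrow> nat \<Rightarrow> token \<Rightarrow> nat)
    \<Rightarrow> (nat \<Rightarrow> nat \<Rightarrow> bool) \<Rightarrow> nat \<Rightarrow> real \<Rightarrow> nat \<Rightarrow> bool" where
  "solves p R init step out N gamma T \<longleftrightarrow>
     (\<forall>E f. is_graph N E \<and> f ` {0..<N} \<subseteq> {0..<N} \<longrightarrow>
        (mono_edges E f = 0 \<longrightarrow> prob_answer p R init step out N E f False \<ge> 2/3) \<and>
        (real (mono_edges E f) \<ge> gamma * real T \<longrightarrow> prob_answer p R init step out N E f True \<ge> 2/3))"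

end

theory Submission
  imports Defs
begin

text \<open>The hard graphs are disjoint unions of \<open>m \<approx> N / t\<close> cliques on \<open>t = 2\<^sup>k\<close> vertices, where
  \<open>t\<^sup>2 \<approx> \<gamma> T\<close>. In every clique one randomly selected vertex is marked with probability \<open>1/2\<close>,
  and all marked vertices share one colour: there is no monochromatic edge. Marking all of one
  clique creates at least \<open>\<gamma> T\<close> of them.

  Cut the stream into \<open>O(t\<^sup>2)\<close> blocks and let the transcript consist of the memory states at the
  block boundaries in all passes, \<open>O(p t\<^sup>2 s)\<close> bits. By the birthday bound the vertices of a clique
  mostly lie in distinct blocks. Then the law of the transcript is a product over
  the vertices of the clique, and the cut-and-paste property bounds the squared Hellinger distance
  between marking none and marking all of the clique by a constant times the sum of the
  squared distances for marking single vertices. By the level-one inequality for subsets of the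
  cube, the average of the latter over the selected vertices is \<open>O(p t\<^sup>2 s / m)\<close>. So
  a successful algorithm has \<open>t \<cdot> p t\<^sup>2 s / m = \<Omega>(1)\<close>, that is,
  \<open>s = \<Omega>(m / (p t\<^sup>3)) = \<Omega>(N / (p t\<^sup>4))\<close>.\<close>

section \<open>The level-one inequality\<close>

text \<open>Hoeffding's lemma for a uniform sign, with \<open>h = 2 * y\<close> and
  \<open>p = 1 / 2\<close>; evenness in \<open>x\<close> reduces it to nonnegative
  arguments.\<close>

lemma exp_plus_exp_minus_le:
  fixes x :: real
  shows "exp x + exp (- x) \<le> 2 * exp (x\<^sup>2 / 2)"
proof -
  have *: "exp y + exp (- y) \<le> 2 * exp (y\<^sup>2 / 2)" if y: "0 \<le> y" for y :: real
  proof -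
    have "- (2 * y) * (1 / 2) + ln (1 + 1 / 2 * (exp (2 * y) - 1)) \<le> (2 * y)\<^sup>2 / 8"
      using y by (intro Hoeffdings_lemma_aux) auto
    then have "ln ((1 + exp (2 * y)) / 2) \<le> y + y\<^sup>2 / 2"
      by (simp add: field_simps)
    then have "exp (ln ((1 + exp (2 * y)) / 2)) \<le> exp (y + y\<^sup>2 / 2)"
      by simp
    then have "(1 + exp (2 * y)) / 2 \<le> exp (y + y\<^sup>2 / 2)"
      by (simp add: add_pos_pos)
    then have "exp (- y) * (1 + exp (2 * y)) \<le> exp (- y) * (2 * exp (y + y\<^sup>2 / 2))"
      by (intro mult_left_mono) auto
    also have "\<dots> = 2 * (exp (- y) * exp (y + y\<^sup>2 / 2))" by simp
    finally show ?thesis by (simp add: distrib_left flip: exp_add)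
  qed
  show ?thesis
    using *[of x] *[of "- x"] by (cases "x \<ge> 0") (auto simp: add.commute)
qed

text \<open>Identifies \<open>Pow R\<close> with a cube of signs; the mean of \<open>spin v\<close>
  over a family is its bias in coordinate \<open>v\<close>.\<close>

definition spin :: "'a \<Rightarrow> 'a set \<Rightarrow> real" where
  "spin v Y = (if v \<in> Y then - 1 else 1)"

text \<open>The moment generating function of a linear form in independent signs factorises;
  \<open>prod_add\<close> expands the product over subsets.\<close>

lemma sum_Pow_exp_spin:
  assumes "finite R"
  shows "(\<Sum>Y\<in>Pow R. exp (\<Sum>v\<in>R. e v * spin v Y)) = (\<Prod>v\<in>R. exp (e v) + exp (- e v))"
proof -
  have "exp (\<Sum>v\<in>R. e v * spin v Y) = (\<Prod>v\<in>Y. exp (- e v)) * (\<Prod>v\<in>R - Y. exp (e v))"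
    if "Y \<in> Pow R" for Y
  proof -
    have "finite Y" using that assms finite_subset by auto
    have "exp (\<Sum>v\<in>R. e v * spin v Y) = (\<Prod>v\<in>R. exp (e v * spin v Y))"
      using assms by (simp add: exp_sum)
    also have "\<dots> = (\<Prod>v\<in>R - Y. exp (e v * spin v Y)) * (\<Prod>v\<in>Y. exp (e v * spin v Y))"
      using that assms by (intro prod.subset_diff) auto
    also have "(\<Prod>v\<in>R - Y. exp (e v * spin v Y)) = (\<Prod>v\<in>R - Y. exp (e v))"
      by (intro prod.cong) (auto simp: spin_def)
    also have "(\<Prod>v\<in>Y. exp (e v * spin v Y)) = (\<Prod>v\<in>Y. exp (- e v))"
      by (intro prod.cong) (auto simp: spin_def)
    finally show ?thesis by (simp add: mult.commute)
  qed
  then have "(\<Sum>Y\<in>Pow R. exp (\<Sum>v\<in>R. e v * spin v Y)) = (\<Prod>v\<in>R. exp (- e v) + exp (e v))"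
    by (simp add: prod_add[OF assms])
  then show ?thesis by (simp add: add.commute)
qed

text \<open>Jensen's inequality for the exponential on \<open>\<A>\<close>, whose moment generating function is at
  most that of the whole cube.\<close>
lemma level_one_inequality:
  fixes R :: "'a set"
  assumes R: "finite R" and A: "\<A> \<subseteq> Pow R" "\<A> \<noteq> {}"
  defines "e \<equiv> \<lambda>v. (\<Sum>Y\<in>\<A>. spin v Y) / card \<A>"
  shows "(\<Sum>v\<in>R. (e v)\<^sup>2) \<le> 2 * ln (2 ^ card R / card \<A>)"
proof -
  have finA: "finite \<A>" using A R finite_subset by blast
  then have a: "real (card \<A>) > 0" using A by (simp add: card_gt_0_iff)
  \<comment> \<open>The linear form points in the direction of the bias vector itself, so its mean
    over the family is the squared norm \<open>\<mu>\<close>.\<close>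
  define g where "g Y = (\<Sum>v\<in>R. e v * spin v Y)" for Y
  define \<mu> where "\<mu> = (\<Sum>v\<in>R. (e v)\<^sup>2)"
  have mean: "(\<Sum>Y\<in>\<A>. g Y) = card \<A> * \<mu>"
  proof -
    have "(\<Sum>Y\<in>\<A>. g Y) = (\<Sum>v\<in>R. e v * (\<Sum>Y\<in>\<A>. spin v Y))"
      unfolding g_def by (subst sum.swap) (simp add: sum_distrib_left)
    also have "\<dots> = (\<Sum>v\<in>R. e v * (card \<A> * e v))"
      using a by (simp add: e_def)
    also have "\<dots> = card \<A> * \<mu>"
      unfolding \<mu>_def sum_distrib_left sum_divide_distrib
      by (intro sum.cong) (auto simp: power2_eq_square)
    finally show ?thesis .
  qed
  have "card \<A> * exp \<mu> = (\<Sum>Y\<in>\<A>. exp \<mu> * (1 + (g Y - \<mu>)))"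
    unfolding sum_distrib_left[symmetric] by (simp add: sum.distrib sum_subtractf mean)
  also have "\<dots> \<le> (\<Sum>Y\<in>\<A>. exp (g Y))"
  proof (rule sum_mono)
    fix Y
    have "exp \<mu> * (1 + (g Y - \<mu>)) \<le> exp \<mu> * exp (g Y - \<mu>)"
      by (intro mult_left_mono exp_ge_add_one_self) auto
    also have "\<dots> = exp (g Y)" by (simp flip: exp_add)
    finally show "exp \<mu> * (1 + (g Y - \<mu>)) \<le> exp (g Y)" .
  qed
  also have "\<dots> \<le> (\<Sum>Y\<in>Pow R. exp (g Y))"
    using R A by (intro sum_mono2) auto
  also have "\<dots> = (\<Prod>v\<in>R. exp (e v) + exp (- e v))"
    unfolding g_def by (rule sum_Pow_exp_spin[OF R])
  also have "\<dots> \<le> (\<Prod>v\<in>R. 2 * exp ((e v)\<^sup>2 / 2))"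
    by (intro prod_mono conjI exp_plus_exp_minus_le) (auto intro: add_nonneg_nonneg)
  also have "\<dots> = 2 ^ card R * exp (\<mu> / 2)"
    unfolding \<mu>_def by (simp add: prod.distrib exp_sum R power_divide sum_divide_distrib)
  finally have "exp \<mu> \<le> 2 ^ card R / card \<A> * exp (\<mu> / 2)"
    using a by (simp add: field_simps)
  then have "exp \<mu> / exp (\<mu> / 2) \<le> 2 ^ card R / card \<A>"
    by (simp add: field_simps)
  then have "exp (\<mu> / 2) \<le> 2 ^ card R / card \<A>"
    by (simp flip: exp_diff)
  then have "\<mu> / 2 \<le> ln (2 ^ card R / card \<A>)"
    using a by (subst ln_ge_iff) auto
  then show ?thesis by (simp add: \<mu>_def)
qed

section \<open>Laws of a function of random marks, and their Hellinger distances\<close>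

definition hits :: "('a set \<Rightarrow> 'b) \<Rightarrow> 'a set \<Rightarrow> 'a set \<Rightarrow> 'b \<Rightarrow> nat" where
  "hits M R S \<tau> = card {Y \<in> Pow R. M (Y \<union> S) = \<tau>}"

text \<open>The vertices of \<open>R\<close> are marked by independent fair coins, those of
  \<open>S\<close> are marked for certain; \<open>M\<close> will be the transcript.\<close>

definition law :: "('a set \<Rightarrow> 'b) \<Rightarrow> 'a set \<Rightarrow> 'a set \<Rightarrow> 'b \<Rightarrow> real" where
  "law M R S \<tau> = hits M R S \<tau> / 2 ^ card R"

text \<open>Twice the squared Hellinger distance.\<close>
definition hell :: "('a set \<Rightarrow> 'b) \<Rightarrow> 'b set \<Rightarrow> 'a set \<Rightarrow> 'a set \<Rightarrow> 'a set \<Rightarrow> real" where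
  "hell M \<Omega> R S S' = (\<Sum>\<tau>\<in>\<Omega>. (sqrt (law M R S \<tau>) - sqrt (law M R S' \<tau>))\<^sup>2)"

lemma law_nonneg: "law M R S \<tau> \<ge> 0"
  by (simp add: law_def)

lemma hell_nonneg: "hell M \<Omega> R S S' \<ge> 0"
  by (simp add: hell_def sum_nonneg)

lemma sum_law:
  assumes "finite R" "finite \<Omega>" "\<And>Y. M Y \<in> \<Omega>" "P \<subseteq> \<Omega>"
  shows "(\<Sum>\<tau>\<in>P. law M R S \<tau>) = card {Y \<in> Pow R. M (Y \<union> S) \<in> P} / 2 ^ card R"
proof -
  have fin: "finite P" using assms finite_subset by auto
  have "{Y \<in> Pow R. M (Y \<union> S) \<in> P} = (\<Union>\<tau>\<in>P. {Y \<in> Pow R. M (Y \<union> S) = \<tau>})" by auto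
  then have "card {Y \<in> Pow R. M (Y \<union> S) \<in> P} = (\<Sum>\<tau>\<in>P. hits M R S \<tau>)"
    unfolding hits_def using fin assms(1) by (simp only:, subst card_UN_disjoint) auto
  then show ?thesis by (simp add: law_def sum_divide_distrib)
qed

lemma sum_law_eq_1:
  assumes "finite R" "finite \<Omega>" "\<And>Y. M Y \<in> \<Omega>"
  shows "(\<Sum>\<tau>\<in>\<Omega>. law M R S \<tau>) = 1"
proof -
  have "{Y \<in> Pow R. M (Y \<union> S) \<in> \<Omega>} = Pow R" using assms by auto
  then show ?thesis
    using sum_law[OF assms(1,2), of M \<Omega> S] assms by (simp add: card_Pow)
qed

text \<open>Compares a Hellinger term with the triangular discrimination
  \<open>(x - y)\<^sup>2 / (x + y)\<close>, in a form that also covers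
  \<open>x + y = 0\<close>.\<close>

lemma sqrt_diff_square_le:
  fixes x y :: real
  assumes "x \<ge> 0" "y \<ge> 0"
  shows "(sqrt x - sqrt y)\<^sup>2 * (x + y) \<le> (x - y)\<^sup>2"
proof -
  have xy: "x = (sqrt x)\<^sup>2" "y = (sqrt y)\<^sup>2" using assms by auto
  have "(sqrt x - sqrt y)\<^sup>2 * ((sqrt x)\<^sup>2 + (sqrt y)\<^sup>2) \<le> (sqrt x - sqrt y)\<^sup>2 * (sqrt x + sqrt y)\<^sup>2"
    using assms by (intro mult_left_mono) (auto simp: power2_sum)
  also have "\<dots> = ((sqrt x)\<^sup>2 - (sqrt y)\<^sup>2)\<^sup>2"
    by (simp add: power2_eq_square algebra_simps)
  finally show ?thesis using xy by simp
qed

text \<open>On the fibre of \<open>\<tau>\<close>, the Hellinger term of \<open>v\<close> is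
  controlled by the squared bias of \<open>v\<close>. The level-one inequality sums these biases to
  at most \<open>2 * ln (1 / q)\<close>, where \<open>q\<close> is the probability of the fibre, and
  the mean of \<open>ln (1 / q)\<close> is an entropy, at most
  \<open>ln (card \<Omega>)\<close>.\<close>

lemma hell_sum_le:
  fixes M :: "'a set \<Rightarrow> 'b"
  assumes R: "finite R" and \<Omega>: "finite \<Omega>" "\<And>Y. M Y \<in> \<Omega>"
  shows "(\<Sum>v\<in>R. hell M \<Omega> (R - {v}) {} {v}) \<le> 4 * ln (card \<Omega>)"
proof -
  define n where "n = card R"
  define a where "a \<tau> = real (hits M R {} \<tau>)" for \<tau>
  define B where "B \<tau> = {Y \<in> Pow R. M Y = \<tau>}" for \<tau>
  define e where "e \<tau> v = (\<Sum>Y\<in>B \<tau>. spin v Y) / card (B \<tau>)" for \<tau> v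
  have aB: "a \<tau> = card (B \<tau>)" for \<tau> by (simp add: a_def B_def hits_def)
  have finB: "finite (B \<tau>)" for \<tau> using R by (simp add: B_def)
  have summand: "(sqrt (law M (R - {v}) {} \<tau>) - sqrt (law M (R - {v}) {v} \<tau>))\<^sup>2 \<le> 2 / 2 ^ n * (a \<tau> * (e \<tau> v)\<^sup>2)"
    if v: "v \<in> R" for v \<tau>
  proof -
    define x where "x = real (hits M (R - {v}) {} \<tau>)"
    define y where "y = real (hits M (R - {v}) {v} \<tau>)"
    \<comment> \<open>Source of the factor 2 in \<open>summand\<close>: the laws live on a cube with
      one coordinate fewer.\<close>
    have nn: "2 ^ n = 2 * (2::real) ^ card (R - {v})"
      unfolding n_def using R v by (metis card_Suc_Diff1 power_Suc)
    define B0 where "B0 = {Y \<in> Pow (R - {v}). M Y = \<tau>}"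
    define B1 where "B1 = {Y \<in> Pow (R - {v}). M (insert v Y) = \<tau>}"
    have split: "B \<tau> = B0 \<union> insert v ` B1"
    proof
      show "B \<tau> \<subseteq> B0 \<union> insert v ` B1"
      proof
        fix Y assume Y: "Y \<in> B \<tau>"
        show "Y \<in> B0 \<union> insert v ` B1"
        proof (cases "v \<in> Y")
          case True
          then have "Y = insert v (Y - {v})" by auto
          moreover have "Y - {v} \<in> B1" using Y True by (auto simp: B_def B1_def insert_absorb)
          ultimately show ?thesis by blast
        next
          case False
          then show ?thesis using Y by (auto simp: B_def B0_def)
        qed
      qed
      show "B0 \<union> insert v ` B1 \<subseteq> B \<tau>" using v by (auto simp: B_def B0_def B1_def)
    qed
    have disj: "B0 \<inter> insert v ` B1 = {}" by (auto simp: B0_def)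
    have inj: "inj_on (insert v) B1"
      by (rule inj_onI) (auto simp: B1_def subset_Diff_insert insert_ident)
    have fin: "finite B0" "finite B1" using R by (auto simp: B0_def B1_def)
    have x: "x = card B0" and y: "y = card B1" by (auto simp: x_def y_def hits_def B0_def B1_def)
    have axy: "a \<tau> = x + y"
      unfolding aB split x y using fin disj by (subst card_Un_disjoint) (auto simp: card_image[OF inj])
    have "(\<Sum>Y\<in>B \<tau>. spin v Y) = (\<Sum>Y\<in>B0. spin v Y) + (\<Sum>Y\<in>insert v ` B1. spin v Y)"
      unfolding split using fin disj by (intro sum.union_disjoint) auto
    also have "(\<Sum>Y\<in>B0. spin v Y) = (\<Sum>Y\<in>B0. 1)"
      by (intro sum.cong) (auto simp: B0_def spin_def)
    also have "(\<Sum>Y\<in>insert v ` B1. spin v Y) = (\<Sum>Y\<in>insert v ` B1. - 1)"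
      by (intro sum.cong) (auto simp: spin_def)
    finally have s: "(\<Sum>Y\<in>B \<tau>. spin v Y) = x - y"
      by (simp add: x y card_image[OF inj])
    have e: "e \<tau> v = (x - y) / (x + y)" using s axy aB by (simp add: e_def)
    have xy0: "x \<ge> 0" "y \<ge> 0" by (auto simp: x_def y_def)
    have main: "(sqrt x - sqrt y)\<^sup>2 \<le> a \<tau> * (e \<tau> v)\<^sup>2"
    proof (cases "x + y = 0")
      case True
      then show ?thesis using xy0 axy by simp
    next
      case False
      then have "x + y > 0" using xy0 by linarith
      then have "(sqrt x - sqrt y)\<^sup>2 \<le> (x - y)\<^sup>2 / (x + y)"
        using sqrt_diff_square_le[OF xy0] by (simp only: pos_le_divide_eq)
      also have "\<dots> = a \<tau> * (e \<tau> v)\<^sup>2"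
        using False by (simp add: e axy power2_eq_square)
      finally show ?thesis .
    qed
    have "(sqrt (law M (R - {v}) {} \<tau>) - sqrt (law M (R - {v}) {v} \<tau>))\<^sup>2 = (sqrt x - sqrt y)\<^sup>2 / 2 ^ card (R - {v})"
      unfolding law_def x_def[symmetric] y_def[symmetric] real_sqrt_divide
        diff_divide_distrib[symmetric] power_divide by simp
    also have "\<dots> = 2 / 2 ^ n * (sqrt x - sqrt y)\<^sup>2" by (simp add: nn)
    also have "\<dots> \<le> 2 / 2 ^ n * (a \<tau> * (e \<tau> v)\<^sup>2)" by (intro mult_left_mono main) auto
    finally show ?thesis .
  qed
  have "\<Omega> \<noteq> {}" using \<Omega> by auto
  then have L: "real (card \<Omega>) > 0" using \<Omega> by (simp add: card_gt_0_iff)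
  have one: "(\<Sum>\<tau>\<in>\<Omega>. a \<tau> / 2 ^ n) = 1"
    using sum_law_eq_1[where M = M and S = "{}", OF R \<Omega>] by (simp add: law_def a_def n_def)
  have "(\<Sum>v\<in>R. hell M \<Omega> (R - {v}) {} {v}) \<le> (\<Sum>v\<in>R. \<Sum>\<tau>\<in>\<Omega>. 2 / 2 ^ n * (a \<tau> * (e \<tau> v)\<^sup>2))"
    unfolding hell_def by (intro sum_mono summand)
  also have "\<dots> = (\<Sum>\<tau>\<in>\<Omega>. 2 * (a \<tau> / 2 ^ n) * (\<Sum>v\<in>R. (e \<tau> v)\<^sup>2))"
    by (subst sum.swap) (simp add: sum_distrib_left mult_ac sum_divide_distrib)
  also have "\<dots> \<le> (\<Sum>\<tau>\<in>\<Omega>. 4 * (a \<tau> / 2 ^ n * ln (card \<Omega>) + (1 / card \<Omega> - a \<tau> / 2 ^ n)))"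
  proof (rule sum_mono)
    fix \<tau> assume "\<tau> \<in> \<Omega>"
    show "2 * (a \<tau> / 2 ^ n) * (\<Sum>v\<in>R. (e \<tau> v)\<^sup>2) \<le> 4 * (a \<tau> / 2 ^ n * ln (card \<Omega>) + (1 / card \<Omega> - a \<tau> / 2 ^ n))"
    proof (cases "B \<tau> = {}")
      case True
      then show ?thesis by (simp add: aB)
    next
      case False
      then have a: "a \<tau> > 0" using finB aB by (simp add: card_gt_0_iff)
      define q where "q = a \<tau> / 2 ^ n"
      have q: "q > 0" using a by (simp add: q_def)
      have "(\<Sum>v\<in>R. (e \<tau> v)\<^sup>2) \<le> 2 * ln (2 ^ n / a \<tau>)"
        unfolding e_def aB n_def by (rule level_one_inequality[OF R _ False]) (auto simp: B_def)
      also have "2 ^ n / a \<tau> = 1 / q" by (simp add: q_def)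
      finally have 1: "(\<Sum>v\<in>R. (e \<tau> v)\<^sup>2) \<le> 2 * ln (1 / q)" .
      have "ln (1 / q) = ln (card \<Omega>) + ln (1 / (card \<Omega> * q))"
        using q L by (simp add: ln_div ln_mult)
      \<comment> \<open>Gibbs' inequality: after weighting by \<open>q\<close>, the error terms
        \<open>1 / card \<Omega> - q\<close> sum to zero over \<open>\<Omega>\<close>.\<close>
      also have "\<dots> \<le> ln (card \<Omega>) + (1 / (card \<Omega> * q) - 1)"
        using q L by (intro add_left_mono ln_le_minus_one) auto
      finally have 2: "(\<Sum>v\<in>R. (e \<tau> v)\<^sup>2) \<le> 2 * (ln (card \<Omega>) + (1 / (card \<Omega> * q) - 1))"
        by (intro order_trans[OF 1] mult_left_mono) auto
      have "2 * q * (\<Sum>v\<in>R. (e \<tau> v)\<^sup>2) \<le> 2 * q * (2 * (ln (card \<Omega>) + (1 / (card \<Omega> * q) - 1)))"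
        using q 2 by (intro mult_left_mono) auto
      also have "\<dots> = 4 * (q * ln (card \<Omega>) + (1 / card \<Omega> - q))"
        using q L by (simp add: field_simps)
      finally show ?thesis by (simp add: q_def)
    qed
  qed
  also have "\<dots> = 4 * ((\<Sum>\<tau>\<in>\<Omega>. a \<tau> / 2 ^ n) * ln (card \<Omega>) + (1 - (\<Sum>\<tau>\<in>\<Omega>. a \<tau> / 2 ^ n)))"
  proof -
    have "(\<Sum>\<tau>\<in>\<Omega>. 4 * (f \<tau> * l + (1 / card \<Omega> - f \<tau>))) = 4 * ((\<Sum>\<tau>\<in>\<Omega>. f \<tau>) * l + (1 - (\<Sum>\<tau>\<in>\<Omega>. f \<tau>)))"
      for f :: "'b \<Rightarrow> real" and l
      using L by (simp add: sum.distrib sum_subtractf sum_distrib_right flip: sum_distrib_left)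
    then show ?thesis .
  qed
  also have "\<dots> = 4 * ln (card \<Omega>)" unfolding one by simp
  finally show ?thesis .
qed

section \<open>Cut and paste\<close>

text \<open>The two sides differ by \<open>2 * S\<^sup>2\<close>, which vanishes exactly when
  \<open>b\<close> is the centroid.\<close>

lemma sum_pairwise_sq_diff_le:
  fixes a :: "'i \<Rightarrow> real"
  assumes "finite I"
  shows "(\<Sum>i\<in>I. \<Sum>j\<in>I. (a i - a j)\<^sup>2) \<le> 2 * card I * (\<Sum>i\<in>I. (b - a i)\<^sup>2)"
proof -
  define c where "c i = b - a i" for i
  define S where "S = (\<Sum>j\<in>I. c j)"
  define Q where "Q = (\<Sum>j\<in>I. (c j)\<^sup>2)"
  have "(\<Sum>j\<in>I. (a i - a j)\<^sup>2) = card I * (c i)\<^sup>2 + Q - 2 * S * c i" for i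
  proof -
    have "(\<Sum>j\<in>I. (a i - a j)\<^sup>2) = (\<Sum>j\<in>I. (c i)\<^sup>2 + (c j)\<^sup>2 - 2 * c i * c j)"
      by (simp add: c_def power2_eq_square algebra_simps)
    then show ?thesis
      by (simp add: sum.distrib sum_subtractf S_def Q_def sum_distrib_left sum_distrib_right mult_ac)
  qed
  then have "(\<Sum>i\<in>I. \<Sum>j\<in>I. (a i - a j)\<^sup>2) = 2 * card I * (\<Sum>i\<in>I. (c i)\<^sup>2) - 2 * S\<^sup>2"
    by (simp add: sum.distrib sum_subtractf Q_def power2_eq_square flip: sum_distrib_left)
      (simp add: S_def)
  also have "\<dots> \<le> 2 * card I * (\<Sum>i\<in>I. (c i)\<^sup>2)" by simp
  finally show ?thesis by (simp add: c_def)
qed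

lemma xor_less_exp:
  fixes i j :: nat
  assumes "i < 2 ^ k" "j < 2 ^ k"
  shows "xor i j < 2 ^ k"
  using assms by (simp flip: take_bit_nat_eq_self_iff)

text \<open>The involutions \<open>i \<mapsto> xor i z\<close> with nonzero \<open>z\<close>
  decompose the complete graph on \<open>2 ^ k\<close> points into perfect matchings: an ordered
  pair belongs to exactly one, that of \<open>z = xor i j\<close>.\<close>

lemma sum_xor_pairs:
  fixes f :: "nat \<Rightarrow> nat \<Rightarrow> real"
  shows "(\<Sum>z\<in>{1..<2 ^ k}. \<Sum>i<2 ^ k. f i (xor i z)) = (\<Sum>i<2 ^ k. \<Sum>j\<in>{..<2 ^ k} - {i}. f i j)"
proof -
  have "(\<Sum>z\<in>{1..<2 ^ k}. f i (xor i z)) = (\<Sum>j\<in>{..<2 ^ k} - {i}. f i j)" if "i < 2 ^ k" for i :: nat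
  proof (rule sum.reindex_bij_witness[of _ "\<lambda>j. xor i j" "\<lambda>z. xor i z"])
    fix z :: nat assume z: "z \<in> {1..<2 ^ k}"
    show zz: "xor i (xor i z) = z" by (simp flip: xor.assoc)
    then show "xor i z \<in> {..<2 ^ k} - {i}" using z that xor_less_exp[of i k z]
      by (metis (no_types, lifting) DiffI atLeastLessThan_iff lessThan_iff not_one_le_zero singletonD xor_self_eq)
  next
    fix j :: nat assume j: "j \<in> {..<2 ^ k} - {i}"
    show zz: "xor i (xor i j) = j" by (simp flip: xor.assoc)
    then have "xor i j \<noteq> 0" using j by (metis DiffD2 singletonI xor.right_neutral)
    then show "xor i j \<in> {1..<2 ^ k}" using j that xor_less_exp[of i k j] by auto
  qed simp
  then show ?thesis by (subst sum.swap) simp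
qed

lemma prod_one_minus_half_powers_ge:
  "(\<Prod>j=1..k. 1 - 1 / 2 ^ j) \<ge> (1 / 4 :: real)"
proof (cases "k = 0")
  case False
  then have "k > 0" by simp
  \<comment> \<open>A bare lower bound would not survive multiplication by a factor below 1, so a
    vanishing slack is added. The induction starts at 1 because its step uses
    \<open>x \<le> 1 / 4\<close>.\<close>
  then have "(\<Prod>j=1..k. 1 - 1 / 2 ^ j) \<ge> (1 / 4 + 1 / 2 ^ (k + 1) :: real)"
  proof (induction k rule: nat_induct_non_zero)
    case (Suc k)
    define x :: real where "x = 1 / 2 ^ (k + 1)"
    have x: "0 \<le> x" "x \<le> 1 / 4"
    proof -
      have "(2::real) ^ 2 \<le> 2 ^ (k + 1)" using Suc.hyps by (intro power_increasing) auto
      then show "x \<le> 1 / 4" unfolding x_def by (simp add: field_simps)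
    qed (simp add: x_def)
    have "1 / 4 + 1 / 2 ^ (Suc k + 1) = 1 / 4 + x / 2" by (simp add: x_def)
    also have "\<dots> \<le> (1 / 4 + x) * (1 - x)"
    proof -
      have "x * x \<le> x * (1 / 4)" using x by (intro mult_left_mono) auto
      moreover have "(1 / 4 + x) * (1 - x) = 1 / 4 + x - x / 4 - x * x" by (simp add: field_simps)
      ultimately show ?thesis by linarith
    qed
    also have "\<dots> \<le> (\<Prod>j=1..k. 1 - 1 / 2 ^ j) * (1 - x)"
      using Suc.IH x by (intro mult_right_mono) (auto simp: x_def)
    also have "\<dots> = (\<Prod>j=1..Suc k. 1 - 1 / 2 ^ j)" by (simp add: x_def)
    finally show ?case .
  qed simp
  moreover have "(0::real) \<le> 1 / 2 ^ (k + 1)" by simp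
  ultimately show ?thesis by linarith
qed simp

text \<open>Since a centre costs at least as much as the centroid, the \<open>2\<^sup>k\<close> distances to \<open>\<psi> {}\<close>
  dominate the pairwise distances, which cut-and-paste turns into distances
  between \<open>\<psi> {}\<close> and pairwise unions. The pairs split into the \<open>2\<^sup>k - 1\<close>
  perfect matchings \<open>i \<mapsto> i xor z\<close>, and each of them is handled by induction.\<close>
lemma sum_dist_singletons_ge_dist_union:
  fixes \<psi> :: "'a set \<Rightarrow> 'b \<Rightarrow> real" and A :: "nat \<Rightarrow> 'a set" and \<Omega> :: "'b set"
  defines "d \<equiv> \<lambda>S S'. \<Sum>\<tau>\<in>\<Omega>. (\<psi> S \<tau> - \<psi> S' \<tau>)\<^sup>2"
  assumes cut_paste: "\<And>S S'. S \<subseteq> G \<Longrightarrow> S' \<subseteq> G \<Longrightarrow> S \<inter> S' = {} \<Longrightarrow> d S S' = d {} (S \<union> S')"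
    and A: "\<And>i. i < 2 ^ k \<Longrightarrow> A i \<subseteq> G" "disjoint_family_on A {..<2 ^ k}"
  shows "(\<Prod>j=1..k. 1 - 1 / 2 ^ j) * d {} (\<Union>i<2 ^ k. A i) \<le> (\<Sum>i<2 ^ k. d {} (A i))"
  using A
proof (induction k arbitrary: A)
  case 0
  then show ?case by (simp add: lessThan_Suc)
next
  case (Suc k)
  define t where "t = (2::nat) ^ Suc k"
  define c :: real where "c = (\<Prod>j=1..k. 1 - 1 / 2 ^ j)"
  have t: "real t > 0" by (simp add: t_def)
  have disj: "A i \<inter> A j = {}" if "i < t" "j < t" "i \<noteq> j" for i j
    using Suc.prems(2) that unfolding disjoint_family_on_def t_def by auto
  have AG: "A i \<subseteq> G" if "i < t" for i using Suc.prems(1) that by (simp add: t_def)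
  have matching: "2 * (c * d {} (\<Union>i<t. A i)) \<le> (\<Sum>i<t. d (A i) (A (xor i z)))"
    if z: "z \<in> {1..<t}" for z
  proof -
    define \<sigma> where "\<sigma> i = xor i z" for i
    have \<sigma>\<sigma>: "\<sigma> (\<sigma> i) = i" for i by (simp add: \<sigma>_def xor.assoc)
    have \<sigma>_ne: "\<sigma> i \<noteq> i" for i
    proof
      assume "\<sigma> i = i"
      then have "xor i (\<sigma> i) = 0" by simp
      then show False using z by (simp add: \<sigma>_def flip: xor.assoc)
    qed
    have \<sigma>_less: "\<sigma> i < t" if "i < t" for i
      using that z unfolding \<sigma>_def t_def by (intro xor_less_exp) auto
    \<comment> \<open>One representative, the smaller endpoint, of each edge of the
      matching.\<close>
    define I where "I = {i. i < t \<and> i < \<sigma> i}"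
    have finI: "finite I" by (simp add: I_def)
    have split: "{..<t} = I \<union> \<sigma> ` I"
    proof
      show "{..<t} \<subseteq> I \<union> \<sigma> ` I"
      proof
        fix i assume i: "i \<in> {..<t}"
        show "i \<in> I \<union> \<sigma> ` I"
        proof (cases "i < \<sigma> i")
          case False
          then have "\<sigma> i \<in> I" using \<sigma>_ne[of i] \<sigma>_less[of i] i by (simp add: I_def \<sigma>\<sigma>)
          then show ?thesis using \<sigma>\<sigma>[of i] by (metis UnI2 imageI)
        qed (use i in \<open>simp add: I_def\<close>)
      qed
    qed (use \<sigma>_less in \<open>auto simp: I_def\<close>)
    have I_disj: "I \<inter> \<sigma> ` I = {}" using \<sigma>\<sigma> by (auto simp: I_def)
    have inj: "inj_on \<sigma> I" by (metis \<sigma>\<sigma> inj_onI)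
    have "t = card I + card I"
      using card_Un_disjoint[OF finI finite_imageI[OF finI] I_disj] card_image[OF inj] split
      by (metis card_lessThan)
    then have "card I = 2 ^ k" by (simp add: t_def)
    then obtain h where h: "bij_betw h {..<(2::nat) ^ k} I"
      using finI ex_bij_betw_nat_finite[of I] by (metis atLeast0LessThan)
    \<comment> \<open>Merging matched sets halves their number and keeps their union, so the
      induction hypothesis applies.\<close>
    define A' where "A' i = A (h i) \<union> A (\<sigma> (h i))" for i
    have hI: "h i \<in> I" if "i < 2 ^ k" for i using h that by (auto simp: bij_betw_def)
    have A'G: "A' i \<subseteq> G" if "i < 2 ^ k" for i
      using hI[OF that] AG \<sigma>_less by (auto simp: A'_def I_def dest!: AG)
    have A'_disj: "disjoint_family_on A' {..<2 ^ k}"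
      unfolding disjoint_family_on_def
    proof (intro ballI impI)
      fix i j :: nat assume ij: "i \<in> {..<2 ^ k}" "j \<in> {..<2 ^ k}" "i \<noteq> j"
      then have ne: "h i \<noteq> h j" using h by (auto simp: bij_betw_def inj_on_def)
      have hh: "h i \<in> I" "h j \<in> I" using hI ij by auto
      then have lt: "h i < t" "h j < t" "\<sigma> (h i) < t" "\<sigma> (h j) < t" using \<sigma>_less by (auto simp: I_def)
      have "h i \<noteq> \<sigma> (h j)" "\<sigma> (h i) \<noteq> h j" using hh I_disj by (metis disjoint_iff imageI)+
      moreover have "\<sigma> (h i) \<noteq> \<sigma> (h j)" using ne \<sigma>\<sigma> by metis
      ultimately have "A (h i) \<inter> A (h j) = {}" "A (h i) \<inter> A (\<sigma> (h j)) = {}"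
        "A (\<sigma> (h i)) \<inter> A (h j) = {}" "A (\<sigma> (h i)) \<inter> A (\<sigma> (h j)) = {}"
        using lt ne by (simp_all add: disj)
      then show "A' i \<inter> A' j = {}" by (auto simp: A'_def)
    qed
    have "(\<Union>i<2 ^ k. A' i) = (\<Union>i\<in>I. A i \<union> A (\<sigma> i))"
      using h by (auto simp: A'_def bij_betw_def)
    also have "\<dots> = (\<Union>i<t. A i)" unfolding split by auto
    finally have union: "(\<Union>i<2 ^ k. A' i) = (\<Union>i<t. A i)" .
    have pair: "d {} (A i \<union> A (\<sigma> i)) = d (A i) (A (\<sigma> i))" if "i \<in> I" for i
      using that \<sigma>_less[of i] by (intro cut_paste[symmetric] AG disj) (auto simp: I_def)
    have sym: "d S S' = d S' S" for S S' by (simp add: d_def power2_commute)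
    have "c * d {} (\<Union>i<t. A i) \<le> (\<Sum>i<2 ^ k. d {} (A' i))"
      unfolding union[symmetric] c_def by (rule Suc.IH[OF A'G A'_disj])
    also have "\<dots> = (\<Sum>i\<in>I. d {} (A i \<union> A (\<sigma> i)))"
      unfolding A'_def by (rule sum.reindex_bij_betw[OF h])
    also have "\<dots> = (\<Sum>i\<in>I. d (A i) (A (\<sigma> i)))" by (rule sum.cong) (auto simp: pair)
    finally have half: "c * d {} (\<Union>i<t. A i) \<le> (\<Sum>i\<in>I. d (A i) (A (\<sigma> i)))" .
    have "(\<Sum>i<t. d (A i) (A (\<sigma> i))) = (\<Sum>i\<in>I. d (A i) (A (\<sigma> i))) + (\<Sum>i\<in>\<sigma> ` I. d (A i) (A (\<sigma> i)))"
      unfolding split using finI I_disj by (intro sum.union_disjoint) auto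
    also have "(\<Sum>i\<in>\<sigma> ` I. d (A i) (A (\<sigma> i))) = (\<Sum>i\<in>I. d (A i) (A (\<sigma> i)))"
      unfolding sum.reindex[OF inj] by (simp add: \<sigma>\<sigma> sym)
    finally show ?thesis using half by (simp add: \<sigma>_def)
  qed
  \<comment> \<open>Summing over all \<open>t - 1\<close> matchings yields all ordered pairs;
    dividing by \<open>t\<close> at the end creates the new factor \<open>1 - 1 / t\<close> of the
    product.\<close>
  have "2 * (real t - 1) * (c * d {} (\<Union>i<t. A i)) = (\<Sum>z\<in>{1..<t}. 2 * (c * d {} (\<Union>i<t. A i)))"
    using t by (simp add: of_nat_diff)
  also have "\<dots> \<le> (\<Sum>z\<in>{1..<t}. \<Sum>i<t. d (A i) (A (xor i z)))"
    by (intro sum_mono matching)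
  also have "\<dots> = (\<Sum>i<t. \<Sum>j\<in>{..<t} - {i}. d (A i) (A j))"
    unfolding t_def by (rule sum_xor_pairs)
  also have "\<dots> \<le> (\<Sum>i<t. \<Sum>j<t. d (A i) (A j))"
    by (intro sum_mono sum_mono2) (auto simp: d_def intro: sum_nonneg)
  also have "\<dots> = (\<Sum>\<tau>\<in>\<Omega>. \<Sum>i<t. \<Sum>j<t. (\<psi> (A i) \<tau> - \<psi> (A j) \<tau>)\<^sup>2)"
    unfolding d_def by (subst (2) sum.swap, subst sum.swap) simp
  also have "\<dots> \<le> (\<Sum>\<tau>\<in>\<Omega>. 2 * card {..<t} * (\<Sum>i<t. (\<psi> {} \<tau> - \<psi> (A i) \<tau>)\<^sup>2))"
    by (intro sum_mono sum_pairwise_sq_diff_le) simp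
  also have "\<dots> = 2 * t * (\<Sum>i<t. d {} (A i))"
  proof -
    have "(\<Sum>i<t. d {} (A i)) = (\<Sum>\<tau>\<in>\<Omega>. \<Sum>i<t. (\<psi> {} \<tau> - \<psi> (A i) \<tau>)\<^sup>2)"
      unfolding d_def by (rule sum.swap)
    then show ?thesis by (simp add: sum_distrib_left)
  qed
  finally have "(real t - 1) * (c * d {} (\<Union>i<t. A i)) \<le> t * (\<Sum>i<t. d {} (A i))"
    by linarith
  then have "(1 - 1 / t) * (c * d {} (\<Union>i<t. A i)) \<le> (\<Sum>i<t. d {} (A i))"
    using t by (simp add: field_simps)
  moreover have "(\<Prod>j=1..Suc k. 1 - 1 / 2 ^ j) = (1 - 1 / real t) * c"
    by (simp add: t_def c_def)
  ultimately show ?case by (simp only: t_def[symmetric] mult.assoc)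
qed

text \<open>The rectangle property of protocols. Exchanging the parts of \<open>Y\<close> and
  \<open>Y'\<close> inside \<open>U\<close> is an involution on pairs; by \<open>mix\<close> it
  preserves the value \<open>\<tau>\<close> while moving \<open>A\<close> from the first input to
  the second.\<close>

lemma hits_cut_paste:
  fixes M :: "'a set \<Rightarrow> 'b"
  assumes R: "finite R" and AU: "A \<subseteq> U" and BU: "B \<inter> U = {}"
    and mix: "\<And>W W'. M W = M W' \<Longrightarrow> M ((W \<inter> U) \<union> (W' - U)) = M W"
  shows "hits M R A \<tau> * hits M R B \<tau> = hits M R {} \<tau> * hits M R (A \<union> B) \<tau>"
proof -
  define H where "H S = {Y \<in> Pow R. M (Y \<union> S) = \<tau>}" for S
  define sw where "sw = (\<lambda>(Y, Y'). ((Y - U) \<union> (Y' \<inter> U), (Y \<inter> U) \<union> (Y' - U)))"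
  have "bij_betw sw (H A \<times> H B) (H {} \<times> H (A \<union> B))"
  proof (rule bij_betw_byWitness[of _ sw])
    show "\<forall>x\<in>H A \<times> H B. sw (sw x) = x" by (auto simp: sw_def)
    show "\<forall>x\<in>H {} \<times> H (A \<union> B). sw (sw x) = x" by (auto simp: sw_def)
    show "sw ` (H A \<times> H B) \<subseteq> H {} \<times> H (A \<union> B)"
    proof (rule image_subsetI)
      fix x assume "x \<in> H A \<times> H B"
      then obtain Y Y' where x: "x = (Y, Y')" and "Y \<in> H A" "Y' \<in> H B" by auto
      then have R': "Y \<subseteq> R" "Y' \<subseteq> R" and *: "M (Y \<union> A) = \<tau>" "M (Y' \<union> B) = \<tau>" by (auto simp: H_def)
      have "M (((Y' \<union> B) \<inter> U) \<union> ((Y \<union> A) - U)) = \<tau>" using mix * by metis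
      moreover have "((Y' \<union> B) \<inter> U) \<union> ((Y \<union> A) - U) = (Y - U) \<union> (Y' \<inter> U) \<union> {}"
        using AU BU by auto
      moreover have "M (((Y \<union> A) \<inter> U) \<union> ((Y' \<union> B) - U)) = \<tau>" using mix * by metis
      moreover have "((Y \<union> A) \<inter> U) \<union> ((Y' \<union> B) - U) = (Y \<inter> U) \<union> (Y' - U) \<union> (A \<union> B)"
        using AU BU by auto
      ultimately show "sw x \<in> H {} \<times> H (A \<union> B)" using R' by (auto simp: x sw_def H_def)
    qed
    show "sw ` (H {} \<times> H (A \<union> B)) \<subseteq> H A \<times> H B"
    proof (rule image_subsetI)
      fix x assume "x \<in> H {} \<times> H (A \<union> B)"
      then obtain Y Y' where x: "x = (Y, Y')" and "Y \<in> H {}" "Y' \<in> H (A \<union> B)" by auto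
      then have R': "Y \<subseteq> R" "Y' \<subseteq> R" and *: "M Y = \<tau>" "M (Y' \<union> (A \<union> B)) = \<tau>" by (auto simp: H_def)
      have "M (((Y' \<union> (A \<union> B)) \<inter> U) \<union> (Y - U)) = \<tau>" using mix * by metis
      moreover have "((Y' \<union> (A \<union> B)) \<inter> U) \<union> (Y - U) = (Y - U) \<union> (Y' \<inter> U) \<union> A"
        using AU BU by auto
      moreover have "M ((Y \<inter> U) \<union> ((Y' \<union> (A \<union> B)) - U)) = \<tau>" using mix * by metis
      moreover have "(Y \<inter> U) \<union> ((Y' \<union> (A \<union> B)) - U) = (Y \<inter> U) \<union> (Y' - U) \<union> B"
        using AU BU by auto
      ultimately show "sw x \<in> H A \<times> H B" using R' by (auto simp: x sw_def H_def)
    qed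
  qed
  then have "card (H A \<times> H B) = card (H {} \<times> H (A \<union> B))" by (rule bij_betw_same_card)
  then show ?thesis by (simp add: card_cartesian_product hits_def H_def)
qed

lemma hell_cut_paste:
  fixes M :: "'a set \<Rightarrow> 'b"
  assumes R: "finite R" and \<Omega>: "finite \<Omega>" "\<And>Y. M Y \<in> \<Omega>"
    and "A \<subseteq> U" "B \<inter> U = {}"
    and mix: "\<And>W W'. M W = M W' \<Longrightarrow> M ((W \<inter> U) \<union> (W' - U)) = M W"
  shows "hell M \<Omega> R A B = hell M \<Omega> R {} (A \<union> B)"
proof -
  \<comment> \<open>In this form the distance depends only on products of two laws, which
    cut-and-paste preserves.\<close>
  have *: "hell M \<Omega> R S S' = 2 - 2 * (\<Sum>\<tau>\<in>\<Omega>. sqrt (law M R S \<tau> * law M R S' \<tau>))" for S S'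
  proof -
    have "hell M \<Omega> R S S' = (\<Sum>\<tau>\<in>\<Omega>. law M R S \<tau> + law M R S' \<tau> - 2 * sqrt (law M R S \<tau> * law M R S' \<tau>))"
      unfolding hell_def by (intro sum.cong) (auto simp: power2_diff law_nonneg real_sqrt_mult)
    then show ?thesis
      using sum_law_eq_1[where M = M, OF R \<Omega>]
      by (simp add: sum_subtractf sum.distrib sum_distrib_left)
  qed
  have "real (hits M R A \<tau>) * real (hits M R B \<tau>) = real (hits M R {} \<tau>) * real (hits M R (A \<union> B) \<tau>)" for \<tau>
    using hits_cut_paste[where M = M, OF R assms(4,5) mix, of \<tau>] by (simp flip: of_nat_mult)
  then have "law M R A \<tau> * law M R B \<tau> = law M R {} \<tau> * law M R (A \<union> B) \<tau>" for \<tau>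
    by (simp add: law_def)
  then show ?thesis unfolding * by simp
qed

text \<open>The vectors of square roots of the laws play the role of \<open>\<psi>\<close>; the
  constant 4 is the inverse of the lower bound on the product. The set \<open>U\<close> may depend
  on \<open>A\<close> and \<open>B\<close>.\<close>

lemma hell_singletons_ge:
  fixes M :: "'a set \<Rightarrow> 'b"
  assumes R: "finite R" and \<Omega>: "finite \<Omega>" "\<And>Y. M Y \<in> \<Omega>"
    and mix: "\<And>A B. A \<subseteq> G \<Longrightarrow> B \<subseteq> G \<Longrightarrow> A \<inter> B = {} \<Longrightarrow>
      \<exists>U. A \<subseteq> U \<and> B \<inter> U = {} \<and> (\<forall>W W'. M W = M W' \<longrightarrow> M ((W \<inter> U) \<union> (W' - U)) = M W)"
    and G: "card G = 2 ^ k"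
  shows "hell M \<Omega> R {} G \<le> 4 * (\<Sum>v\<in>G. hell M \<Omega> R {} {v})"
proof -
  have "finite G" using G by (metis card.infinite power_not_zero zero_neq_numeral)
  then obtain h where h: "bij_betw h {..<(2::nat) ^ k} G"
    using ex_bij_betw_nat_finite[of G] G by (metis atLeast0LessThan)
  define \<psi> where "\<psi> S \<tau> = sqrt (law M R S \<tau>)" for S \<tau>
  have hd: "hell M \<Omega> R S S' = (\<Sum>\<tau>\<in>\<Omega>. (\<psi> S \<tau> - \<psi> S' \<tau>)\<^sup>2)" for S S'
    by (simp add: hell_def \<psi>_def)
  have "(\<Prod>j=1..k. 1 - 1 / 2 ^ j) * hell M \<Omega> R {} (\<Union>i<2 ^ k. {h i}) \<le> (\<Sum>i<2 ^ k. hell M \<Omega> R {} {h i})"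
    unfolding hd
  proof (rule sum_dist_singletons_ge_dist_union[where G = G])
    fix S S' assume "S \<subseteq> G" "S' \<subseteq> G" "S \<inter> S' = {}"
    then obtain U where "S \<subseteq> U" "S' \<inter> U = {}" "\<And>W W'. M W = M W' \<Longrightarrow> M ((W \<inter> U) \<union> (W' - U)) = M W"
      using mix by metis
    then have "hell M \<Omega> R S S' = hell M \<Omega> R {} (S \<union> S')"
      by (intro hell_cut_paste R \<Omega>)
    then show "(\<Sum>\<tau>\<in>\<Omega>. (\<psi> S \<tau> - \<psi> S' \<tau>)\<^sup>2) = (\<Sum>\<tau>\<in>\<Omega>. (\<psi> {} \<tau> - \<psi> (S \<union> S') \<tau>)\<^sup>2)"
      by (simp add: hd)
  qed (use h in \<open>auto simp: bij_betw_def inj_on_def disjoint_family_on_def\<close>)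
  also have "(\<Union>i<2 ^ k. {h i}) = G" using h by (auto simp: bij_betw_def)
  also have "(\<Sum>i<2 ^ k. hell M \<Omega> R {} {h i}) = (\<Sum>v\<in>G. hell M \<Omega> R {} {v})"
    by (rule sum.reindex_bij_betw[OF h])
  finally have "(\<Prod>j=1..k. 1 - 1 / 2 ^ j) * hell M \<Omega> R {} G \<le> (\<Sum>v\<in>G. hell M \<Omega> R {} {v})" .
  moreover have "1 / 4 * hell M \<Omega> R {} G \<le> (\<Prod>j=1..k. 1 - 1 / 2 ^ j) * hell M \<Omega> R {} G"
    by (intro mult_right_mono prod_one_minus_half_powers_ge hell_nonneg)
  ultimately show ?thesis by linarith
qed

text \<open>A bound linear in \<open>hell\<close>, rather than in its square root, can be averaged
  later. Its price is the additive \<open>1 / 12\<close>, which the acceptance gap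
  \<open>1 / 3\<close> can afford.\<close>

lemma law_diff_le_hell:
  fixes M :: "'a set \<Rightarrow> 'b"
  assumes R: "finite R" and \<Omega>: "finite \<Omega>" "\<And>Y. M Y \<in> \<Omega>" and P: "P \<subseteq> \<Omega>"
  shows "(\<Sum>\<tau>\<in>P. law M R S \<tau>) - (\<Sum>\<tau>\<in>P. law M R S' \<tau>) \<le> 12 * hell M \<Omega> R S' S + 1 / 12"
proof -
  have "finite P" using P \<Omega> finite_subset by auto
  define bnd where "bnd \<tau> = 12 * (sqrt (law M R S' \<tau>) - sqrt (law M R S \<tau>))\<^sup>2 + (law M R S \<tau> + law M R S' \<tau>) / 24" for \<tau>
  have "law M R S \<tau> - law M R S' \<tau> \<le> bnd \<tau>" for \<tau>
  proof -
    define x where "x = sqrt (law M R S \<tau>)"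
    define y where "y = sqrt (law M R S' \<tau>)"
    have xy: "law M R S \<tau> = x\<^sup>2" "law M R S' \<tau> = y\<^sup>2" by (auto simp: x_def y_def law_nonneg)
    \<comment> \<open>Weighted AM-GM for the product \<open>(x - y) * (x + y)\<close>.\<close>
    have "0 \<le> 12 * ((x - y) - (x + y) / 24)\<^sup>2" by simp
    also have "\<dots> = 12 * (y - x)\<^sup>2 + (x + y)\<^sup>2 / 48 - (x\<^sup>2 - y\<^sup>2)"
      by (simp add: power2_eq_square field_simps)
    finally have "x\<^sup>2 - y\<^sup>2 \<le> 12 * (y - x)\<^sup>2 + (x + y)\<^sup>2 / 48" by simp
    moreover have "(x + y)\<^sup>2 \<le> 2 * (x\<^sup>2 + y\<^sup>2)"
      using zero_le_power2[of "x - y"] by (simp add: power2_eq_square algebra_simps)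
    ultimately have "x\<^sup>2 - y\<^sup>2 \<le> 12 * (y - x)\<^sup>2 + (x\<^sup>2 + y\<^sup>2) / 24" by linarith
    then show ?thesis unfolding bnd_def xy by (simp add: x_def y_def law_nonneg)
  qed
  then have "(\<Sum>\<tau>\<in>P. law M R S \<tau> - law M R S' \<tau>) \<le> (\<Sum>\<tau>\<in>P. bnd \<tau>)" by (rule sum_mono)
  also have "\<dots> \<le> (\<Sum>\<tau>\<in>\<Omega>. bnd \<tau>)"
    using P \<Omega> by (intro sum_mono2) (auto simp: bnd_def law_nonneg)
  also have "\<dots> = 12 * hell M \<Omega> R S' S + 1 / 12"
    using sum_law_eq_1[where M = M, OF R \<Omega>]
    by (simp add: bnd_def hell_def sum.distrib sum_distrib_left flip: sum_divide_distrib)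
  finally show ?thesis by (simp add: sum_subtractf)
qed

section \<open>Transcripts and the random order\<close>

text \<open>The time \<open>a\<close> encodes pass \<open>a div N\<close> and stream position \<open>a mod N\<close>.\<close>
primrec state :: "nat \<Rightarrow> (nat \<Rightarrow> nat \<Rightarrow> token \<Rightarrow> nat) \<Rightarrow> nat \<Rightarrow> (nat \<Rightarrow> token list) \<Rightarrow> nat \<Rightarrow> nat" where
  "state N \<delta> q ch 0 = q"
| "state N \<delta> q ch (Suc a) = foldl (\<delta> (a div N)) (state N \<delta> q ch a) (ch (a mod N))"

definition chunk :: "nat set set \<Rightarrow> (nat \<Rightarrow> nat) \<Rightarrow> nat list \<Rightarrow> nat \<Rightarrow> token list" where
  "chunk E f ps i = VTok (ps ! i) (f (ps ! i)) #
     map (\<lambda>u. ETok (ps ! i) u) (filter (\<lambda>u. {ps ! i, u} \<in> E) (take i ps))"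

lemma state_within_pass:
  assumes "i \<le> N"
  shows "state N \<delta> q ch (j * N + i) = foldl (\<delta> j) (state N \<delta> q ch (j * N)) (concat (map ch [0..<i]))"
  using assms by (induction i) auto

lemma foldl_passes_eq_state:
  "foldl (\<lambda>q j. foldl (\<delta> j) q (concat (map ch [0..<N]))) q [0..<p] = state N \<delta> q ch (p * N)"
proof (induction p)
  case (Suc p)
  then show ?case using state_within_pass[of N N \<delta> q ch p] by (simp add: add.commute)
qed simp

lemma run_alg_eq_state:
  assumes "length ps = N"
  shows "run_alg p init step out r (va_stream E f ps) =
    out r (state N (step r) (init r) (chunk E f ps) (p * N))"
proof -
  have "va_stream E f ps = concat (map (chunk E f ps) [0..<N])"
    using assms by (simp add: va_stream_def chunk_def[abs_def])
  then show ?thesis by (simp add: run_alg_def foldl_passes_eq_state)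
qed

lemma state_less:
  assumes "uses_space s init step"
  shows "state N (step r) (init r) ch a < 2 ^ s"
proof (induction a)
  case (Suc a)
  have "foldl (step r j) q xs < 2 ^ s" if "q < 2 ^ s" for j q xs
    using that assms by (induction xs arbitrary: q) (auto simp: uses_space_def)
  then show ?case using Suc by simp
qed (use assms in \<open>simp add: uses_space_def\<close>)

text \<open>Blocks of length \<open>B\<close> restart in every pass. The final time
  \<open>p * N\<close> is a boundary, so the transcript determines the output.\<close>

definition boundaries :: "nat \<Rightarrow> nat \<Rightarrow> nat \<Rightarrow> nat set" where
  "boundaries p N B = {a. a \<le> p * N \<and> a mod N mod B = 0}"

lemma finite_boundaries: "finite (boundaries p N B)"
  by (rule finite_subset[of _ "{..p * N}"]) (auto simp: boundaries_def)

lemma card_boundaries_le: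
  assumes "N > 0" "N \<le> B * k"
  shows "card (boundaries p N B) \<le> (p + 1) * k"
proof -
  \<comment> \<open>The pass index \<open>p\<close> itself occurs, at the final time; hence
    \<open>p + 1\<close> in the bound.\<close>
  have "boundaries p N B \<subseteq> (\<lambda>(j, b). j * N + b * B) ` ({..p} \<times> {..<k})"
  proof
    fix a assume a: "a \<in> boundaries p N B"
    define b where "b = a mod N div B"
    have b: "a mod N = b * B" using a unfolding b_def boundaries_def by auto
    have "b * B < N" using assms(1) b mod_less_divisor by metis
    then have "b * B < k * B" using assms(2) by (simp only: mult.commute[of k])
    then have "b < k" by simp
    moreover have "a div N \<le> p" using a assms(1) unfolding boundaries_def
      by (metis (mono_tags, lifting) div_le_mono mem_Collect_eq nonzero_mult_div_cancel_right not_gr_zero)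
    moreover have "a = a div N * N + b * B" using b by (metis div_mult_mod_eq)
    ultimately show "a \<in> (\<lambda>(j, b). j * N + b * B) ` ({..p} \<times> {..<k})" by force
  qed
  then have "card (boundaries p N B) \<le> card ({..p} \<times> {..<k})"
    by (meson card_image_le card_mono finite_SigmaI finite_atMost finite_imageI finite_lessThan le_trans)
  then show ?thesis by (simp add: card_cartesian_product)
qed

text \<open>Inside a block the state depends only on the state at its start and on the tokens of the
  block. At boundaries both runs agree, so the spliced run can follow either one through the next
  block.\<close>

lemma state_splice:
  assumes agree: "\<And>a. a \<in> boundaries p N B \<Longrightarrow> state N \<delta> q ch1 a = state N \<delta> q ch2 a"
    and N: "N > 0"
    and ch1: "\<And>i. i < N \<Longrightarrow> i div B \<in> Q \<Longrightarrow> ch3 i = ch1 i"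
    and ch2: "\<And>i. i < N \<Longrightarrow> i div B \<notin> Q \<Longrightarrow> ch3 i = ch2 i"
    and "a \<le> p * N"
  shows "state N \<delta> q ch3 a = (if a mod N div B \<in> Q then state N \<delta> q ch1 a else state N \<delta> q ch2 a)"
  using \<open>a \<le> p * N\<close>
proof (induction a)
  case (Suc a)
  define i where "i = a mod N"
  have i: "i < N" using N by (simp add: i_def)
  have step: "state N \<delta> q ch3 (Suc a) =
      (if i div B \<in> Q then state N \<delta> q ch1 (Suc a) else state N \<delta> q ch2 (Suc a))"
    using Suc ch1[OF i] ch2[OF i] by (simp add: i_def)
  show ?case
  proof (cases "Suc a \<in> boundaries p N B")
    case True
    then show ?thesis using step agree by metis
  next
    case False
    then have ne: "Suc a mod N mod B \<noteq> 0" using Suc.prems by (simp add: boundaries_def)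
    then have "Suc a mod N = Suc i" unfolding i_def by (metis mod_Suc mod_0)
    then have "Suc a mod N div B = i div B" using ne by (simp add: div_Suc)
    then show ?thesis using step by simp
  qed
qed simp

text \<open>Vertex \<open>N - 1\<close> must carry no edge, since its own colour is the one shared by \<open>W\<close>.\<close>
definition colouring :: "nat \<Rightarrow> nat set \<Rightarrow> nat \<Rightarrow> nat" where
  "colouring N W v = (if v \<in> W then N - 1 else v)"

definition separated :: "nat \<Rightarrow> nat \<Rightarrow> nat set \<Rightarrow> nat list \<Rightarrow> bool" where
  "separated N B G ps \<longleftrightarrow>
     (\<forall>a<N. \<forall>b<N. a \<noteq> b \<and> a div B = b div B \<longrightarrow> \<not> (ps ! a \<in> G \<and> ps ! b \<in> G))"

text \<open>With \<open>restrict\<close>, equality of transcripts means agreement at the boundaries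
  only, and a bounded memory leaves finitely many transcripts.\<close>

definition transcript :: "nat \<Rightarrow> nat \<Rightarrow> nat \<Rightarrow> (nat \<Rightarrow> nat \<Rightarrow> token \<Rightarrow> nat) \<Rightarrow> nat \<Rightarrow> nat set set
    \<Rightarrow> nat list \<Rightarrow> nat set \<Rightarrow> nat \<Rightarrow> nat" where
  "transcript p N B \<delta> q E ps W =
     restrict (state N \<delta> q (chunk E (colouring N W) ps)) (boundaries p N B)"

text \<open>\<open>U\<close> collects all vertices in blocks that meet \<open>A\<close>; separation
  keeps \<open>A'\<close> out of them. A chunk depends on the marked set only through the colour of
  its own vertex, so splicing marked sets along \<open>U\<close> splices the streams block by
  block.\<close>

lemma transcript_splice:
  fixes p q :: nat and \<delta> :: "nat \<Rightarrow> nat \<Rightarrow> token \<Rightarrow> nat" and E :: "nat set set"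
  assumes N: "N > 0" and ps: "ps \<in> orders N" and sep: "separated N B G ps" and G: "G \<subseteq> {..<N}"
    and AB: "A \<subseteq> G" "A' \<subseteq> G" "A \<inter> A' = {}"
  defines "M \<equiv> transcript p N B \<delta> q E ps"
  shows "\<exists>U. A \<subseteq> U \<and> A' \<inter> U = {} \<and> (\<forall>W W'. M W = M W' \<longrightarrow> M ((W \<inter> U) \<union> (W' - U)) = M W)"
proof -
  have dist: "distinct ps" and set: "set ps = {..<N}"
    using ps by (simp_all add: orders_def atLeast0LessThan)
  then have len: "length ps = N" by (metis card_lessThan distinct_card)
  define Q where "Q = {a div B |a. a < N \<and> ps ! a \<in> A}"
  define U where "U = {ps ! a |a. a < N \<and> a div B \<in> Q}"
  have inU: "ps ! i \<in> U \<longleftrightarrow> i div B \<in> Q" if "i < N" for i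
    using that dist len by (auto simp: U_def nth_eq_iff_index_eq)
  have "A \<subseteq> U"
  proof
    fix v assume v: "v \<in> A"
    then have "v \<in> set ps" using AB G set by auto
    then obtain a where a: "a < N" "v = ps ! a" using len by (metis in_set_conv_nth)
    then show "v \<in> U" using v inU[of a] by (auto simp: Q_def)
  qed
  moreover have "A' \<inter> U = {}"
  proof (rule ccontr)
    assume "A' \<inter> U \<noteq> {}"
    then obtain a a' where a: "a < N" "a' < N" "ps ! a \<in> A'" "ps ! a' \<in> A" "a div B = a' div B"
      by (auto simp: U_def Q_def)
    then have "a \<noteq> a'" using AB by auto
    then show False using a AB sep unfolding separated_def by blast
  qed
  moreover have "M ((W \<inter> U) \<union> (W' - U)) = M W" if eq: "M W = M W'" for W W'
  proof -
    define st where "st X = state N \<delta> q (chunk E (colouring N X) ps)" for X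
    have agree: "st W a = st W' a" if "a \<in> boundaries p N B" for a
      using fun_cong[OF eq, of a] that by (simp add: M_def transcript_def st_def)
    have "st ((W \<inter> U) \<union> (W' - U)) a = st W a" if a: "a \<in> boundaries p N B" for a
    proof -
      have "st ((W \<inter> U) \<union> (W' - U)) a = (if a mod N div B \<in> Q then st W a else st W' a)"
        unfolding st_def
      proof (rule state_splice[OF _ N])
        show "state N \<delta> q (chunk E (colouring N W) ps) a = state N \<delta> q (chunk E (colouring N W') ps) a"
          if "a \<in> boundaries p N B" for a
          using agree[OF that] by (simp add: st_def)
      qed (use a inU in \<open>auto simp: chunk_def colouring_def boundaries_def\<close>)
      then show ?thesis using agree[OF a] by simp
    qed
    then show ?thesis by (auto simp: M_def transcript_def st_def restrict_def)
  qed
  ultimately show ?thesis by blast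
qed

lemma transcript_in:
  assumes "uses_space s init step"
  shows "transcript p N B (step r) (init r) E ps W \<in> boundaries p N B \<rightarrow>\<^sub>E {..<2 ^ s}"
  unfolding transcript_def using state_less[OF assms] by (intro restrict_PiE_iff[THEN iffD2]) auto

lemma run_alg_eq_transcript:
  assumes "length ps = N"
  shows "run_alg p init step out r (va_stream E (colouring N W) ps) =
    out r (transcript p N B (step r) (init r) E ps W (p * N))"
  using run_alg_eq_state[OF assms] by (simp add: transcript_def boundaries_def)

section \<open>Birthday bound for uniformly random orders\<close>

lemma orders_eq: "orders N = permutations_of_set {0..<N}"
  by (auto simp: orders_def permutations_of_set_def)

lemma finite_orders: "finite (orders N)"
  by (simp add: orders_eq)

lemma orders_nonempty: "orders N \<noteq> {}"
  by (simp add: orders_eq)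

lemma orders_nth:
  assumes "ps \<in> orders N" "a < N"
  shows "ps ! a < N" "length ps = N"
proof -
  show "length ps = N" using assms distinct_card[of ps] by (simp add: orders_def)
  then show "ps ! a < N" using assms nth_mem[of a ps] by (auto simp: orders_def)
qed

text \<open>By symmetry: relabelling vertices injects the orders counted here into those for any
  other ordered pair of distinct vertices, and these \<open>N * (N - 1)\<close> classes are
  disjoint.\<close>

lemma card_orders_two_positions:
  assumes ab: "a < N" "b < N" "a \<noteq> b" and uv: "u < N" "v < N" "u \<noteq> v"
  shows "card {ps \<in> orders N. ps ! a = u \<and> ps ! b = v} * (N * (N - 1)) \<le> card (orders N)"
proof -
  define S where "S = (\<lambda>(u, v). {ps \<in> orders N. ps ! a = u \<and> ps ! b = v})"
  define D where "D = Sigma {..<N} (\<lambda>u. {..<N} - {u})"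
  have "card (S (u, v)) \<le> card (S w)" if "w \<in> D" for w
  proof -
    obtain u' v' where w: "w = (u', v')" "u' < N" "v' < N" "u' \<noteq> v'"
      using \<open>w \<in> D\<close> by (auto simp: D_def)
    \<comment> \<open>First \<open>u\<close> goes to \<open>u'\<close>; then the current image of
      \<open>v\<close> goes to \<open>v'\<close>, which leaves \<open>u'\<close> in place.\<close>
    define \<pi> where "\<pi> = Transposition.transpose (Transposition.transpose u u' v) v' \<circ> Transposition.transpose u u'"
    have "Transposition.transpose u u' v < N" using uv w by (simp add: Transposition.transpose_def)
    then have \<pi>: "\<pi> permutes {0..<N}"
      unfolding \<pi>_def using uv w by (intro permutes_compose permutes_swap_id) auto
    have "\<pi> u = u'" "\<pi> v = v'" using uv w by (auto simp: \<pi>_def Transposition.transpose_def)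
    have inj: "inj \<pi>" using \<pi> by (rule permutes_inj)
    show ?thesis
    proof (rule card_inj_on_le[of "map \<pi>"])
      show "inj_on (map \<pi>) (S (u, v))" using inj by (simp add: inj_on_def inj_map_eq_map)
      show "map \<pi> ` S (u, v) \<subseteq> S w"
      proof (rule image_subsetI)
        fix ps assume "ps \<in> S (u, v)"
        then have ps: "ps \<in> orders N" "ps ! a = u" "ps ! b = v" by (auto simp: S_def)
        have "map \<pi> ps \<in> orders N"
          using ps(1) inj permutes_image[OF \<pi>]
          by (auto simp: orders_def distinct_map intro: inj_on_subset)
        then show "map \<pi> ps \<in> S w"
          using ps orders_nth[OF ps(1)] ab \<open>\<pi> u = u'\<close> \<open>\<pi> v = v'\<close> by (simp add: S_def w)
      qed
      show "finite (S w)" by (auto simp: S_def w finite_orders)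
    qed
  qed
  then have "card D * card (S (u, v)) \<le> (\<Sum>w\<in>D. card (S w))"
    using sum_mono[of D "\<lambda>_. card (S (u, v))" "\<lambda>w. card (S w)"] by simp
  also have "\<dots> = card (\<Union>w\<in>D. S w)"
    by (rule card_UN_disjoint[symmetric]) (auto simp: D_def S_def finite_orders)
  also have "\<dots> \<le> card (orders N)"
    by (intro card_mono) (auto simp: S_def finite_orders)
  finally have "card D * card (S (u, v)) \<le> card (orders N)" .
  moreover have "card D = N * (N - 1)" by (simp add: D_def)
  ultimately show ?thesis by (simp add: S_def mult.commute)
qed

text \<open>Union bound over ordered pairs of positions in a common block, at most
  \<open>N * (B - 1)\<close> of them, and ordered pairs of distinct vertices of
  \<open>G\<close>.\<close>

lemma card_not_separated_le:
  assumes G: "G \<subseteq> {..<N}" and N: "N > 0" and B: "B > 0"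
  shows "card {ps \<in> orders N. \<not> separated N B G ps} * (N - 1) \<le> (card G)\<^sup>2 * (B - 1) * card (orders N)"
proof -
  define P where "P = Sigma {..<N} (\<lambda>a. {b. b < N \<and> b \<noteq> a \<and> a div B = b div B})"
  define D where "D = Sigma G (\<lambda>u. G - {u})"
  define S where "S = (\<lambda>((a, b), (u, v)). {ps \<in> orders N. ps ! a = u \<and> ps ! b = v})"
  have finG: "finite G" using G finite_subset by blast
  have finP: "finite P" by (auto simp: P_def)
  have finD: "finite D" using finG by (auto simp: D_def)
  have "{ps \<in> orders N. \<not> separated N B G ps} \<subseteq> (\<Union>x\<in>P \<times> D. S x)"
  proof
    fix ps assume "ps \<in> {ps \<in> orders N. \<not> separated N B G ps}"
    then obtain a b where ps: "ps \<in> orders N" and ab: "a < N" "b < N" "a \<noteq> b" "a div B = b div B"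
      "ps ! a \<in> G" "ps ! b \<in> G" by (auto simp: separated_def)
    have "ps ! a \<noteq> ps ! b" using ps ab orders_nth(2)[OF ps ab(1)]
      by (auto simp: orders_def nth_eq_iff_index_eq)
    then have "((a, b), (ps ! a, ps ! b)) \<in> P \<times> D" using ab by (auto simp: P_def D_def)
    moreover have "ps \<in> S ((a, b), (ps ! a, ps ! b))" using ps by (simp add: S_def)
    ultimately show "ps \<in> (\<Union>x\<in>P \<times> D. S x)" by blast
  qed
  then have "card {ps \<in> orders N. \<not> separated N B G ps} \<le> card (\<Union>x\<in>P \<times> D. S x)"
    using finP finD by (intro card_mono) (auto simp: S_def finite_orders)
  also have "\<dots> \<le> (\<Sum>x\<in>P \<times> D. card (S x))"
    using finP finD by (intro card_UN_le) auto
  finally have "card {ps \<in> orders N. \<not> separated N B G ps} * (N * (N - 1)) \<le> (\<Sum>x\<in>P \<times> D. card (S x) * (N * (N - 1)))"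
    by (simp add: sum_distrib_right[symmetric] mult_right_mono del: sum_constant)
  also have "\<dots> \<le> (\<Sum>x\<in>P \<times> D. card (orders N))"
  proof (rule sum_mono)
    fix x assume "x \<in> P \<times> D"
    then obtain a b u v where x: "x = ((a, b), (u, v))" "a < N" "b < N" "b \<noteq> a" "u \<in> G" "v \<in> G" "v \<noteq> u"
      by (auto simp: P_def D_def)
    then have "u < N" "v < N" using G by auto
    with x show "card (S x) * (N * (N - 1)) \<le> card (orders N)"
      using card_orders_two_positions[of a N b u v] by (simp add: S_def)
  qed
  also have "\<dots> = card P * card D * card (orders N)" by (simp add: card_cartesian_product)
  also have "\<dots> \<le> (N * (B - 1)) * (card G)\<^sup>2 * card (orders N)"
  proof (intro mult_right_mono mult_mono)
    have "card {b. b < N \<and> b \<noteq> a \<and> a div B = b div B} \<le> B - 1" if "a < N" for a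
    proof -
      have "{b. b < N \<and> b \<noteq> a \<and> a div B = b div B} \<subseteq> {a div B * B..<a div B * B + B} - {a}"
        using B by (auto simp: div_times_less_eq_dividend dividend_less_div_times add.commute
            intro: dividend_less_times_div)
      then have "card {b. b < N \<and> b \<noteq> a \<and> a div B = b div B} \<le> card ({a div B * B..<a div B * B + B} - {a})"
        by (intro card_mono) auto
      also have "\<dots> = B - 1"
        using B by (subst card_Diff_singleton) (auto simp: add.commute dividend_less_div_times)
      finally show ?thesis .
    qed
    then have "(\<Sum>a<N. card {b. b < N \<and> b \<noteq> a \<and> a div B = b div B}) \<le> (\<Sum>a<N. B - 1)"
      by (intro sum_mono) auto
    then show "card P \<le> N * (B - 1)" by (simp add: P_def)
    have "card D \<le> card (G \<times> G)" using finG by (intro card_mono) (auto simp: D_def)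
    then show "card D \<le> (card G)\<^sup>2" by (simp add: card_cartesian_product power2_eq_square)
  qed auto
  finally have "N * (card {ps \<in> orders N. \<not> separated N B G ps} * (N - 1)) \<le> N * ((card G)\<^sup>2 * (B - 1) * card (orders N))"
    by (simp add: mult_ac)
  then show ?thesis using N by simp
qed

section \<open>Clique instances\<close>

definition clique :: "nat \<Rightarrow> nat \<Rightarrow> nat set" where
  "clique t j = {j * t..<(j + 1) * t}"

definition clique_edges :: "nat \<Rightarrow> nat \<Rightarrow> nat set set" where
  "clique_edges m t = {e. \<exists>j<m. e \<subseteq> clique t j \<and> card e = 2}"

definition selections :: "nat \<Rightarrow> nat \<Rightarrow> (nat \<Rightarrow> nat) set" where
  "selections m t = (\<Pi>\<^sub>E j\<in>{..<m}. clique t j)"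

text \<open>The vertices marked at random while clique \<open>i\<close> is tested. Removing the
  index \<open>i\<close> makes the set independent of \<open>d i\<close>, which permits resampling
  \<open>d i\<close>.\<close>

definition others :: "nat \<Rightarrow> (nat \<Rightarrow> nat) \<Rightarrow> nat \<Rightarrow> nat set" where
  "others m d i = d ` ({..<m} - {i})"

lemma card_clique: "card (clique t j) = t"
  by (simp add: clique_def)

lemma finite_clique: "finite (clique t j)"
  by (simp add: clique_def)

lemma clique_subset:
  assumes "j < m"
  shows "clique t j \<subseteq> {..<m * t}"
proof -
  have "(j + 1) * t \<le> m * t" using assms by (intro mult_right_mono) auto
  then show ?thesis by (auto simp: clique_def)
qed

lemma clique_disjoint:
  assumes "v \<in> clique t i" "v \<in> clique t j"
  shows "i = j"
proof -
  have "v div t = l" if "v \<in> clique t l" for l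
    using that by (intro div_nat_eqI) (auto simp: clique_def mult.commute)
  then show ?thesis using assms by metis
qed

lemma card_selections: "card (selections m t) = t ^ m"
  by (simp add: selections_def card_PiE card_clique)

lemma selections_D: "d \<in> selections m t \<Longrightarrow> j < m \<Longrightarrow> d j \<in> clique t j"
  by (auto simp: selections_def)

lemma inj_on_selections: "d \<in> selections m t \<Longrightarrow> inj_on d {..<m}"
  by (rule inj_onI) (metis clique_disjoint lessThan_iff selections_D)

lemma finite_others: "finite (others m d i)"
  by (simp add: others_def)

lemma others_eq:
  assumes "d \<in> selections m t" "i < m"
  shows "others m d i = d ` {..<m} - {d i}"
  using inj_on_selections[OF assms(1)] assms(2) by (auto simp: others_def inj_on_def)

lemma is_graph_clique_edges:
  assumes "m * t \<le> N"
  shows "is_graph N (clique_edges m t)"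
  unfolding is_graph_def clique_edges_def
  using assms clique_subset[of _ m t] by (fastforce simp: subset_eq)

text \<open>A clique contains at most one marked vertex, and unmarked vertices keep their own
  colours. The common colour \<open>N - 1\<close> is not the label of a clique vertex, since
  \<open>m * t < N\<close>.\<close>

lemma mono_edges_at_most_one_per_clique:
  assumes "m * t < N" and d: "d \<in> selections m t" and W: "W \<subseteq> d ` {..<m}"
  shows "mono_edges (clique_edges m t) (colouring N W) = 0"
proof -
  have "{e \<in> clique_edges m t. \<exists>u v. e = {u, v} \<and> colouring N W u = colouring N W v} = {}"
  proof (rule ccontr)
    assume "\<not> ?thesis"
    then obtain u v j where j: "j < m" and uv: "u \<in> clique t j" "v \<in> clique t j" "card {u, v} = 2"
      and eq: "colouring N W u = colouring N W v"
      by (auto simp: clique_edges_def)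
    have ne: "u \<noteq> v" using uv(3) by auto
    have one: "w = d j" if w: "w \<in> clique t j" "w \<in> W" for w
    proof -
      obtain l where l: "l < m" "w = d l" using w W by auto
      then show ?thesis using clique_disjoint selections_D[OF d l(1)] w(1) by metis
    qed
    have "u < N - 1" "v < N - 1" using uv clique_subset[OF j, of t] assms(1) by auto
    then show False using eq ne one uv by (auto simp: colouring_def split: if_splits)
  qed
  then show ?thesis unfolding mono_edges_def by (simp only: card.empty)
qed

lemma mono_edges_full_clique:
  assumes "i < m" "clique t i \<subseteq> W"
  shows "t choose 2 \<le> mono_edges (clique_edges m t) (colouring N W)"
proof -
  have fin: "finite (clique_edges m t)"
  proof (rule finite_subset)
    show "clique_edges m t \<subseteq> Pow {..<m * t}"
      using clique_subset[of _ m t] by (fastforce simp: clique_edges_def)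
  qed simp
  have "t choose 2 = card {e. e \<subseteq> clique t i \<and> card e = 2}"
    using n_subsets[OF finite_clique, of t i 2] by (simp add: card_clique)
  also have "\<dots> \<le> mono_edges (clique_edges m t) (colouring N W)"
    unfolding mono_edges_def
  proof (rule card_mono)
    show "{e. e \<subseteq> clique t i \<and> card e = 2} \<subseteq>
      {e \<in> clique_edges m t. \<exists>u v. e = {u, v} \<and> colouring N W u = colouring N W v}"
    proof
      fix e assume "e \<in> {e. e \<subseteq> clique t i \<and> card e = 2}"
      then have e: "e \<subseteq> clique t i" "card e = 2" by auto
      then obtain u v where uv: "e = {u, v}" by (auto simp: card_2_iff)
      then have "colouring N W u = colouring N W v" using e assms(2) by (auto simp: colouring_def)
      then show "e \<in> {e \<in> clique_edges m t. \<exists>u v. e = {u, v} \<and> colouring N W u = colouring N W v}"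
        using e uv assms(1) by (auto simp: clique_edges_def)
    qed
  qed (use fin in simp)
  finally show ?thesis .
qed

lemma colouring_range:
  assumes "N > 0"
  shows "colouring N W ` {0..<N} \<subseteq> {0..<N}"
  using assms by (auto simp: colouring_def)

text \<open>Resampling coordinate \<open>i\<close> preserves the uniform law on selections:
  \<open>(d, v) \<mapsto> (d(i := v), d i)\<close> is an involution.\<close>

lemma sum_selections_update:
  fixes h :: "(nat \<Rightarrow> nat) \<Rightarrow> real"
  assumes "i < m"
  shows "(\<Sum>d\<in>selections m t. \<Sum>v\<in>clique t i. h (d(i := v))) = t * (\<Sum>d\<in>selections m t. h d)"
proof -
  have upd: "d(i := v) \<in> selections m t" if "d \<in> selections m t" "v \<in> clique t i" for d v
    using that assms unfolding selections_def by (auto simp: PiE_iff extensional_def)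
  have "(\<Sum>d\<in>selections m t. \<Sum>v\<in>clique t i. h (d(i := v))) =
      (\<Sum>(d, v)\<in>selections m t \<times> clique t i. h (d(i := v)))"
    by (rule sum.cartesian_product)
  also have "\<dots> = (\<Sum>(d, v)\<in>selections m t \<times> clique t i. h d)"
    using upd selections_D[OF _ assms]
    by (intro sum.reindex_bij_witness[of _ "\<lambda>(d, v). (d(i := v), d i)" "\<lambda>(d, v). (d(i := v), d i)"]) auto
  also have "\<dots> = (\<Sum>d\<in>selections m t. \<Sum>v\<in>clique t i. h d)"
    by (rule sum.cartesian_product[symmetric])
  finally show ?thesis by (simp add: card_clique sum_distrib_left)
qed

text \<open>For a fixed order and seed. Separated cliques, those in \<open>I\<close>, pay through
  the Hellinger distance, the others trivially 1. Resampling turns the sum over the vertices of a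
  clique into \<open>t\<close> times the term of the selected vertex, and for fixed \<open>d\<close>
  these terms are summed over \<open>i\<close> by \<open>hell_sum_le\<close>. The constant is
  \<open>192 = 12 * 4 * 4\<close>.\<close>

lemma sum_acceptance_gap_le:
  fixes M :: "nat set \<Rightarrow> 'b"
  assumes \<Omega>: "finite \<Omega>" "\<And>Y. M Y \<in> \<Omega>" and P: "P \<subseteq> \<Omega>" and I: "I \<subseteq> {..<m}"
    and t: "t = 2 ^ k"
    and mix: "\<And>i A A'. i \<in> I \<Longrightarrow> A \<subseteq> clique t i \<Longrightarrow> A' \<subseteq> clique t i \<Longrightarrow> A \<inter> A' = {} \<Longrightarrow>
      \<exists>U. A \<subseteq> U \<and> A' \<inter> U = {} \<and> (\<forall>W W'. M W = M W' \<longrightarrow> M ((W \<inter> U) \<union> (W' - U)) = M W)"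
  defines "pr \<equiv> \<lambda>R S. (\<Sum>\<tau>\<in>P. law M R S \<tau>)"
  shows "(\<Sum>i<m. \<Sum>d\<in>selections m t. pr (others m d i) (clique t i) - pr (others m d i) {})
    \<le> real t ^ m * (card ({..<m} - I) + m / 12 + 192 * real t * ln (card \<Omega>))"
proof -
  define h where "h i d = hell M \<Omega> (others m d i) {} (clique t i)" for i d
  define g where "g i d = hell M \<Omega> (others m d i) {} {d i}" for i d
  have finI: "finite I" using I finite_subset by blast
  have gap: "pr (others m d i) (clique t i) - pr (others m d i) {} \<le>
      (if i \<in> I then 12 * h i d else 1) + 1 / 12" for i d
  proof (cases "i \<in> I")
    case True
    then show ?thesis
      using law_diff_le_hell[where M = M, OF finite_others \<Omega> P, of m d i "clique t i" "{}"]
      by (simp add: pr_def h_def)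
  next
    case False
    have "pr (others m d i) (clique t i) \<le> 1"
      using sum_law_eq_1[where M = M, OF finite_others \<Omega>, of m d i "clique t i"]
        sum_mono2[OF \<Omega>(1) P, of "law M (others m d i) (clique t i)"]
      by (simp add: pr_def law_nonneg)
    moreover have "pr (others m d i) {} \<ge> 0" by (simp add: pr_def sum_nonneg law_nonneg)
    ultimately show ?thesis using False by simp
  qed
  have h: "(\<Sum>d\<in>selections m t. h i d) \<le> 4 * (t * (\<Sum>d\<in>selections m t. g i d))" if i: "i \<in> I" for i
  proof -
    have im: "i < m" using i I by auto
    have "h i d \<le> 4 * (\<Sum>v\<in>clique t i. g i (d(i := v)))" for d
    proof -
      have "others m (d(i := v)) i = others m d i" for v by (auto simp: others_def)
      moreover have "card (clique t i) = 2 ^ k" using t by (simp only: card_clique)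
      then have "h i d \<le> 4 * (\<Sum>v\<in>clique t i. hell M \<Omega> (others m d i) {} {v})"
        unfolding h_def by (rule hell_singletons_ge[where M = M, OF finite_others \<Omega> mix[OF i], rotated 3])
      ultimately show ?thesis by (simp add: g_def)
    qed
    then have "(\<Sum>d\<in>selections m t. h i d) \<le> (\<Sum>d\<in>selections m t. 4 * (\<Sum>v\<in>clique t i. g i (d(i := v))))"
      by (rule sum_mono)
    then show ?thesis
      using sum_selections_update[OF im, where t = t and h = "g i"] by (simp flip: sum_distrib_left)
  qed
  have g: "(\<Sum>i<m. g i d) \<le> 4 * ln (card \<Omega>)" if d: "d \<in> selections m t" for d
  proof -
    have "(\<Sum>i<m. g i d) = (\<Sum>i<m. hell M \<Omega> (d ` {..<m} - {d i}) {} {d i})"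
      unfolding g_def by (intro sum.cong) (auto simp: others_eq[OF d])
    also have "\<dots> = (\<Sum>v\<in>d ` {..<m}. hell M \<Omega> (d ` {..<m} - {v}) {} {v})"
      using sum.reindex[OF inj_on_selections[OF d], of "\<lambda>v. hell M \<Omega> (d ` {..<m} - {v}) {} {v}"] by simp
    also have "\<dots> \<le> 4 * ln (card \<Omega>)" by (intro hell_sum_le \<Omega>) auto
    finally show ?thesis .
  qed
  have "(\<Sum>i\<in>I. \<Sum>d\<in>selections m t. h i d) \<le> (\<Sum>i\<in>I. 4 * (t * (\<Sum>d\<in>selections m t. g i d)))"
    by (rule sum_mono[OF h])
  also have "\<dots> \<le> (\<Sum>i<m. 4 * (t * (\<Sum>d\<in>selections m t. g i d)))"
    using I by (intro sum_mono2) (auto simp: g_def intro!: mult_nonneg_nonneg sum_nonneg hell_nonneg)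
  also have "\<dots> = 4 * real t * (\<Sum>d\<in>selections m t. \<Sum>i<m. g i d)"
    by (subst sum.swap) (simp add: mult.assoc flip: sum_distrib_left)
  also have "\<dots> \<le> 4 * real t * (\<Sum>d\<in>selections m t. 4 * ln (card \<Omega>))"
    by (intro mult_left_mono sum_mono g) auto
  also have "\<dots> = 16 * real t * real t ^ m * ln (card \<Omega>)" by (simp add: card_selections)
  finally have total: "(\<Sum>i\<in>I. \<Sum>d\<in>selections m t. h i d) \<le> 16 * real t * real t ^ m * ln (card \<Omega>)" .
  have "(\<Sum>i<m. \<Sum>d\<in>selections m t. pr (others m d i) (clique t i) - pr (others m d i) {})
    \<le> (\<Sum>i<m. \<Sum>d\<in>selections m t. (if i \<in> I then 12 * h i d else 1) + 1 / 12)"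
    by (intro sum_mono gap)
  also have "\<dots> = (\<Sum>i<m. \<Sum>d\<in>selections m t. if i \<in> I then 12 * h i d else 1) + m * real t ^ m / 12"
    by (simp add: sum.distrib card_selections)
  also have "(\<Sum>i<m. \<Sum>d\<in>selections m t. if i \<in> I then 12 * h i d else 1) =
      (\<Sum>i<m. if i \<in> I then 12 * (\<Sum>d\<in>selections m t. h i d) else real t ^ m)"
    by (intro sum.cong) (auto simp: card_selections sum_distrib_left)
  also have "\<dots> = 12 * (\<Sum>i\<in>I. \<Sum>d\<in>selections m t. h i d) + card ({..<m} - I) * real t ^ m"
  proof -
    have "{..<m} \<inter> I = I" "{..<m} \<inter> - I = {..<m} - I" using I by auto
    then show ?thesis by (simp add: sum.If_cases sum_distrib_left)
  qed
  also have "\<dots> + m * real t ^ m / 12 \<le> 12 * (16 * real t * real t ^ m * ln (card \<Omega>)) + card ({..<m} - I) * real t ^ m + m * real t ^ m / 12"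
    using total by simp
  also have "\<dots> = real t ^ m * (card ({..<m} - I) + m / 12 + 192 * real t * ln (card \<Omega>))"
    by (simp add: algebra_simps)
  finally show ?thesis .
qed

section \<open>The space bound\<close>

text \<open>Correctness forces an average acceptance gap of at least \<open>1 / 3\<close> over
  cliques, selections and marks; for each order and seed this gap is bounded through the transcript.
  The constant is \<open>13824 = 1152 * 12\<close>, with 12 coming from the number of
  blocks.\<close>

lemma number_of_cliques_le:
  fixes gamma :: real and T :: nat
  assumes space: "uses_space s init step"
    and solves: "solves p R init step out N gamma T"
    and T: "gamma * T \<le> t choose 2" and t: "t = 2 ^ k" and m: "m * t < N" and N: "N \<ge> 2"
  shows "real m \<le> 13824 * (real p + 1) * real s * real t ^ 3"
proof -
  \<comment> \<open>With \<open>12 t\<^sup>2\<close> blocks, two vertices of a fixed clique share a block with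
     probability at most \<open>1 / 12\<close>.\<close>
  define c where "c = 12 * t\<^sup>2"
  have t0: "t > 0" by (simp add: t)
  then have c0: "c > 0" by (simp add: c_def)
  \<comment> \<open>Then \<open>c\<close> blocks cover all \<open>N\<close> positions, while
    \<open>c * (B - 1)\<close> is still at most \<open>N - 1\<close>, as the birthday bound
    wants.\<close>
  define B where "B = (N - 1) div c + 1"
  define E where "E = clique_edges m t"
  define \<mu> where "\<mu> = pair_pmf (pmf_of_set (orders N)) R"
  define acc where "acc W = {(ps, r). run_alg p init step out r (va_stream E (colouring N W) ps) = True}" for W
  define \<Omega> where "\<Omega> = boundaries p N B \<rightarrow>\<^sub>E {..<(2::nat) ^ s}"
  define bad where "bad i = {(ps :: nat list, r :: nat). \<not> separated N B (clique t i) ps}" for i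
  \<comment> \<open>The gap at a single order and seed; its expectation is the sum of the
    differences of acceptance probabilities.\<close>
  define gap where "gap x = (\<Sum>i<m. \<Sum>d\<in>selections m t. \<Sum>Y\<in>Pow (others m d i).
    (indicator (acc (Y \<union> clique t i)) x - indicator (acc Y) x) / 2 ^ card (others m d i) :: real)" for x
  define G where "G x = real t ^ m * ((\<Sum>i<m. indicator (bad i) x) + (real m / 12 + 192 * real t * ln (real (card \<Omega>))))" for x
  have setpmf: "set_pmf \<mu> = orders N \<times> set_pmf R"
    by (simp add: \<mu>_def finite_orders orders_nonempty)
  have fin\<Omega>: "finite \<Omega>" by (simp add: \<Omega>_def finite_boundaries finite_PiE)

  have graph: "is_graph N E" "colouring N W ` {0..<N} \<subseteq> {0..<N}" for W
    using m N by (auto simp: E_def intro!: is_graph_clique_edges colouring_range[THEN subsetD])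
  have no: "measure \<mu> (acc Y) \<le> 1 / 3"
    if "i < m" "d \<in> selections m t" "Y \<subseteq> others m d i" for i d Y
  proof -
    have "Y \<subseteq> d ` {..<m}" using that by (auto simp: others_def)
    then have "mono_edges E (colouring N Y) = 0"
      unfolding E_def using m that by (intro mono_edges_at_most_one_per_clique)
    then have "prob_answer p R init step out N E (colouring N Y) False \<ge> 2 / 3"
      using solves graph unfolding solves_def by blast
    moreover have "prob_answer p R init step out N E (colouring N Y) False = measure \<mu> (UNIV - acc Y)"
      unfolding prob_answer_def \<mu>_def acc_def by (intro arg_cong2[where f = measure]) auto
    moreover have "measure \<mu> (UNIV - acc Y) = 1 - measure \<mu> (acc Y)"
      using measure_pmf.prob_compl[of "acc Y" \<mu>] by simp
    ultimately show ?thesis by simp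
  qed
  have yes: "measure \<mu> (acc (Y \<union> clique t i)) \<ge> 2 / 3" if "i < m" for i Y
  proof -
    have "real (t choose 2) \<le> real (mono_edges E (colouring N (Y \<union> clique t i)))"
      unfolding E_def of_nat_le_iff using that by (intro mono_edges_full_clique) auto
    then have "real (mono_edges E (colouring N (Y \<union> clique t i))) \<ge> gamma * real T"
      using T by linarith
    then have "prob_answer p R init step out N E (colouring N (Y \<union> clique t i)) True \<ge> 2 / 3"
      using solves graph unfolding solves_def by blast
    then show ?thesis by (simp add: prob_answer_def \<mu>_def acc_def)
  qed

  have int_ind: "integrable \<mu> (indicator A :: _ \<Rightarrow> real)" for A
    by (rule measure_pmf.integrable_const_bound[of _ 1]) (auto simp: indicator_def)
  have "real t ^ m * m / 3 = (\<Sum>i<m. \<Sum>d\<in>selections m t. \<Sum>Y\<in>Pow (others m d i).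
      (1 / 3) / 2 ^ card (others m d i))"
    by (simp add: card_Pow finite_others card_selections)
  also have "\<dots> \<le> (\<Sum>i<m. \<Sum>d\<in>selections m t. \<Sum>Y\<in>Pow (others m d i).
      (measure \<mu> (acc (Y \<union> clique t i)) - measure \<mu> (acc Y)) / 2 ^ card (others m d i))"
  proof (intro sum_mono divide_right_mono)
    fix i d Y assume "i \<in> {..<m}" "d \<in> selections m t" "Y \<in> Pow (others m d i)"
    then show "1 / 3 \<le> measure \<mu> (acc (Y \<union> clique t i)) - measure \<mu> (acc Y)"
      using no[of i d Y] yes[of i Y] by simp
  qed simp
  also have "\<dots> = (\<integral>x. gap x \<partial>\<mu>)"
    unfolding gap_def by (simp add: int_ind)
  also have "\<dots> \<le> (\<integral>x. G x \<partial>\<mu>)"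
  proof (rule integral_mono_AE)
    show "integrable \<mu> gap" unfolding gap_def by (simp add: int_ind)
    show "integrable \<mu> G" unfolding G_def by (simp add: int_ind)
    show "AE x in \<mu>. gap x \<le> G x"
    proof (subst AE_measure_pmf_iff, clarify)
      fix ps r assume "(ps, r) \<in> set_pmf \<mu>"
      then have ps: "ps \<in> orders N" using setpmf by auto
      have len: "length ps = N" using orders_nth(2)[OF ps, of 0] N by simp
      define M where "M = transcript p N B (step r) (init r) E ps"
      have M\<Omega>: "M Y \<in> \<Omega>" for Y
        unfolding M_def \<Omega>_def by (rule transcript_in[OF space])
      define P where "P = {\<tau> \<in> \<Omega>. out r (\<tau> (p * N))}"
      have accM: "(ps, r) \<in> acc W \<longleftrightarrow> M W \<in> P" for W
        using run_alg_eq_transcript[OF len] M\<Omega> by (simp add: acc_def P_def M_def)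
      have ind: "(\<Sum>\<tau>\<in>P. law M R' S \<tau>) = (\<Sum>Y\<in>Pow R'. indicator (acc (Y \<union> S)) (ps, r) / 2 ^ card R')"
        if "finite R'" for R' S
      proof -
        have "(\<Sum>\<tau>\<in>P. law M R' S \<tau>) = card {Y \<in> Pow R'. M (Y \<union> S) \<in> P} / 2 ^ card R'"
          by (rule sum_law[OF that fin\<Omega> M\<Omega>]) (auto simp: P_def)
        also have "real (card {Y \<in> Pow R'. M (Y \<union> S) \<in> P}) = (\<Sum>Y\<in>Pow R'. indicator (acc (Y \<union> S)) (ps, r))"
          using that by (simp add: indicator_def accM sum.If_cases Int_def)
        finally show ?thesis by (simp add: sum_divide_distrib)
      qed
      define I where "I = {i. i < m \<and> separated N B (clique t i) ps}"
      have "gap (ps, r) = (\<Sum>i<m. \<Sum>d\<in>selections m t.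
          (\<Sum>\<tau>\<in>P. law M (others m d i) (clique t i) \<tau>) - (\<Sum>\<tau>\<in>P. law M (others m d i) {} \<tau>))"
        unfolding gap_def ind[OF finite_others] by (simp add: sum_subtractf diff_divide_distrib)
      also have "\<dots> \<le> real t ^ m * (card ({..<m} - I) + m / 12 + 192 * real t * ln (real (card \<Omega>)))"
      proof (rule sum_acceptance_gap_le[OF fin\<Omega> M\<Omega> _ _ t])
        fix i A A' assume i: "i \<in> I" and A: "A \<subseteq> clique t i" "A' \<subseteq> clique t i" "A \<inter> A' = {}"
        have "clique t i \<subseteq> {..<N}" using i m clique_subset[of i m t] by (auto simp: I_def)
        then show "\<exists>U. A \<subseteq> U \<and> A' \<inter> U = {} \<and> (\<forall>W W'. M W = M W' \<longrightarrow> M (W \<inter> U \<union> (W' - U)) = M W)"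
          unfolding M_def using N i A by (intro transcript_splice[OF _ ps]) (auto simp: I_def)
      qed (auto simp: P_def I_def)
      also have "real (card ({..<m} - I)) = (\<Sum>i<m. indicator (bad i) (ps, r))"
      proof -
        have "{..<m} - I = {..<m} \<inter> {i. \<not> separated N B (clique t i) ps}" by (auto simp: I_def)
        then show ?thesis by (simp add: bad_def indicator_def sum.If_cases)
      qed
      finally show "gap (ps, r) \<le> G (ps, r)" by (simp add: G_def add.assoc)
    qed
  qed
  also have "\<dots> = real t ^ m * ((\<Sum>i<m. measure \<mu> (bad i)) + (real m / 12 + 192 * real t * ln (real (card \<Omega>))))"
    unfolding G_def by (simp add: int_ind)
  finally have "real t ^ m * (real m / 3) \<le>
      real t ^ m * ((\<Sum>i<m. measure \<mu> (bad i)) + (real m / 12 + 192 * real t * ln (real (card \<Omega>))))"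
    by simp
  then have "real m / 3 \<le> (\<Sum>i<m. measure \<mu> (bad i)) + (real m / 12 + 192 * real t * ln (real (card \<Omega>)))"
    using t0 by (simp only: mult_le_cancel_left_pos zero_less_power of_nat_0_less_iff)
  moreover have "(\<Sum>i<m. measure \<mu> (bad i)) \<le> (\<Sum>i<m. 1 / 12)"
  proof (rule sum_mono)
    fix i assume "i \<in> {..<m}"
    define b where "b = card {ps \<in> orders N. \<not> separated N B (clique t i) ps}"
    have "measure \<mu> (bad i) = measure (map_pmf fst \<mu>) {ps. \<not> separated N B (clique t i) ps}"
      unfolding measure_map_pmf bad_def by (intro arg_cong2[where f = measure]) auto
    also have "\<dots> = real b / real (card (orders N))"
      unfolding \<mu>_def map_fst_pair_pmf b_def
      by (subst measure_pmf_of_set) (auto simp: finite_orders orders_nonempty Int_def)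
    finally have meas: "measure \<mu> (bad i) = real b / real (card (orders N))" .
    have "clique t i \<subseteq> {..<N}"
      using \<open>i \<in> {..<m}\<close> m clique_subset[of i m t] by auto
    then have "b * (N - 1) \<le> t\<^sup>2 * (B - 1) * card (orders N)"
      using card_not_separated_le[of "clique t i" N B] N
      by (simp add: b_def B_def card_clique)
    then have "12 * (b * (N - 1)) \<le> c * (B - 1) * card (orders N)"
      by (simp add: c_def)
    also have "\<dots> \<le> (N - 1) * card (orders N)"
      by (intro mult_right_mono) (auto simp: B_def)
    finally have "(N - 1) * (12 * b) \<le> (N - 1) * card (orders N)" by (simp add: mult_ac)
    then have "12 * b \<le> card (orders N)" using N by simp
    then have "12 * real b \<le> real (card (orders N))" by linarith
    moreover have "card (orders N) > 0" using finite_orders orders_nonempty by (simp add: card_gt_0_iff)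
    ultimately show "measure \<mu> (bad i) \<le> 1 / 12" unfolding meas by (simp add: field_simps)
  qed
  \<comment> \<open>Here \<open>1 / 3 - 1 / 12 - 1 / 12 = 1 / 6\<close> of \<open>m\<close>
    survives, and \<open>6 * 192 = 1152\<close>.\<close>
  ultimately have m1: "real m \<le> 1152 * real t * ln (real (card \<Omega>))" by simp
  have "N \<le> B * c"
    using N dividend_less_times_div[OF c0, of "N - 1"] by (simp add: B_def algebra_simps)
  then have bd: "card (boundaries p N B) \<le> (p + 1) * c" using N by (intro card_boundaries_le) auto
  have "ln (real (card \<Omega>)) = real (card (boundaries p N B)) * (real s * ln 2)"
    by (simp add: \<Omega>_def card_PiE finite_boundaries ln_realpow)
  also have "\<dots> \<le> real ((p + 1) * c) * (real s * 1)"
  proof (intro mult_mono)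
    show "ln (2 :: real) \<le> 1" using ln_le_minus_one[of "2::real"] by simp
  qed (use bd in \<open>simp_all only: of_nat_le_iff, auto\<close>)
  finally have "1152 * real t * ln (real (card \<Omega>)) \<le> 1152 * real t * (real ((p + 1) * c) * (real s * 1))"
    by (intro mult_left_mono) auto
  with m1 show ?thesis by (simp add: c_def power2_eq_square power3_eq_cube algebra_simps)
qed

lemma ex_power_of_two_between:
  fixes x :: real
  assumes "x > 1"
  obtains k where "x \<le> (2 ^ k)\<^sup>2" "(2 ^ k)\<^sup>2 < 4 * x" "k > 0"
proof -
  have ex: "\<exists>k. x \<le> 4 ^ k" using real_arch_pow[of 4 x] by (auto intro: less_imp_le)
  define k where "k = (LEAST k. x \<le> 4 ^ k)"
  have k: "x \<le> 4 ^ k" unfolding k_def by (rule LeastI_ex[OF ex])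
  with assms have k0: "k > 0" by (intro gr0I) auto
  then have "\<not> x \<le> 4 ^ (k - 1)" unfolding k_def by (intro not_less_Least) auto
  moreover have "(4::real) ^ k = 4 * 4 ^ (k - 1)" using k0 by (simp flip: power_Suc)
  moreover have "(2 ^ k)\<^sup>2 = (4::real) ^ k" by (simp add: power2_eq_square flip: power_mult_distrib)
  ultimately show ?thesis using k k0 by (intro that[of k]) auto
qed

theorem theorem5p1:
  shows "\<forall>(p::nat) (gamma::real). gamma > 0 \<longrightarrow>
     (\<exists>(K::nat) (c::real). K \<ge> 1 \<and> c > 0 \<and>
       (\<forall>(n::nat) (T::nat) (s::nat) (R::nat pmf) init step out.
          4 \<le> T \<and> T \<le> n choose 2 \<and> uses_space s init step \<and>
          solves p R init step out (K * n) gamma T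
          \<longrightarrow> c * real n / real T ^ 2 \<le> real s))"
proof (intro allI impI)
  fix p :: nat and gamma :: real
  assume gamma: "gamma > 0"
  \<comment> \<open>Chosen so that \<open>t\<^sup>2 < 16 * (gamma * T + 1)\<close> implies
    \<open>t\<^sup>2 \<le> D * T\<close>. Then \<open>K \<ge> 8 * D\<close> and
    \<open>2 * T \<le> n\<^sup>2\<close> make the graph hold at least four cliques' worth of
    vertices.\<close>
  define D where "D = 16 * (gamma + 1)"
  define K where "K = nat \<lceil>8 * D\<rceil>"
  define c where "c = 1 / (27648 * (real p + 1) * D\<^sup>2)"
  have D: "D > 16" using gamma by (simp add: D_def)
  have K: "real K \<ge> 8 * D" unfolding K_def by (rule of_nat_ceiling)
  have K1: "real K \<ge> 128" using K D by linarith
  have c: "c > 0" using D by (simp add: c_def)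
  have "c * n / (real T)\<^sup>2 \<le> s"
    if T: "4 \<le> T" "T \<le> n choose 2" and alg: "uses_space s init step" "solves p R init step out (K * n) gamma T"
    for n T s R init step out
  proof -
    define N where "N = K * n"
    \<comment> \<open>The lower bound ensures enough edges in one clique: for
      \<open>t \<ge> 2\<close>, \<open>t choose 2\<close> is at least
      \<open>t\<^sup>2 / 4\<close>.\<close>
    obtain k where k: "4 * (gamma * T + 1) \<le> (2 ^ k)\<^sup>2" "(2 ^ k)\<^sup>2 < 4 * (4 * (gamma * T + 1))" "k > 0"
      using ex_power_of_two_between[of "4 * (gamma * T + 1)"] gamma by (auto simp: add_pos_nonneg)
    define t where "t = (2::nat) ^ k"
    \<comment> \<open>Using \<open>N - 1\<close> leaves vertex \<open>N - 1\<close> outside all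
      cliques, so its label can be the common colour.\<close>
    define m where "m = (N - 1) div t"
    have t0: "t > 0" by (simp add: t_def)
    have t2: "real t \<ge> 2" using k(3) power_increasing[of 1 k "2::real"] by (simp add: t_def)
    have sq: "(real t)\<^sup>2 \<le> D * T"
      using k(2) T(1) by (simp add: t_def D_def algebra_simps)
    have n: "n > 0" using T by (intro gr0I) (auto simp: choose_two)
    have "2 * real T \<le> real n ^ 2"
    proof -
      have "2 * T \<le> n * (n - 1)" using T(2) by (simp add: choose_two)
      also have "\<dots> \<le> n ^ 2" by (simp add: power2_eq_square)
      finally show ?thesis by (metis of_nat_le_iff of_nat_mult of_nat_numeral of_nat_power)
    qed
    then have "D * (2 * real T) \<le> D * real n ^ 2" using D by (intro mult_left_mono) auto
    also have "\<dots> \<le> K * real n ^ 2 / 8"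
      using mult_right_mono[OF K, of "real n ^ 2"] by simp
    finally have "16 * (real t)\<^sup>2 \<le> K * real n ^ 2" using sq by linarith
    also have "\<dots> \<le> (K * real K) * real n ^ 2" using K1 by (intro mult_right_mono) auto
    finally have "(4 * real t)\<^sup>2 \<le> (real N)\<^sup>2" by (simp add: N_def power2_eq_square mult_ac)
    then have "4 * real t \<le> real N" by (rule power2_le_imp_le) simp
    then have tN: "4 * t \<le> N" by linarith
    \<comment> \<open>Rounding leaves at most \<open>t\<close> vertices uncovered, a quarter of
      \<open>N\<close> at most.\<close>
    have "real N \<le> 2 * (real m * real t)"
    proof -
      have "N - 1 < m * t + t" unfolding m_def using dividend_less_div_times[OF t0, of "N - 1"] by simp
      then have "N \<le> 2 * (m * t)" using tN t0 by linarith
      then show ?thesis by (metis of_nat_le_iff of_nat_mult of_nat_numeral)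
    qed
    also have "real m \<le> 13824 * (real p + 1) * real s * real t ^ 3"
    proof (rule number_of_cliques_le[OF alg(1) alg(2)[folded N_def] _ t_def])
      have "real (t choose 2) = real t * (real t - 1) / 2"
        using t0 by (subst choose_two) (simp add: real_of_nat_div of_nat_diff)
      moreover have "real t * 2 \<le> real t * real t" using t2 by (intro mult_left_mono) auto
      moreover have "4 * (gamma * T + 1) \<le> real t * real t" using k(1) by (simp add: t_def power2_eq_square)
      ultimately show "gamma * T \<le> t choose 2" by (simp add: algebra_simps)
      have "m * t \<le> N - 1" by (simp add: m_def)
      then show "m * t < N" using tN t0 by linarith
      show "N \<ge> 2" using tN t0 by linarith
    qed
    finally have "real N \<le> 2 * (13824 * (real p + 1) * real s * real t ^ 3 * t)" using t0 by simp
    also have "\<dots> = 27648 * (real p + 1) * s * ((real t)\<^sup>2)\<^sup>2"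
      by (simp add: power2_eq_square power3_eq_cube mult_ac)
    also have "\<dots> \<le> 27648 * (real p + 1) * s * (D * T)\<^sup>2"
      using sq by (intro mult_left_mono power_mono) auto
    finally have "real N \<le> 27648 * (real p + 1) * D\<^sup>2 * (s * (real T)\<^sup>2)"
      by (simp add: power_mult_distrib mult_ac)
    moreover have "real n \<le> real N" using K1 n by (simp add: N_def)
    ultimately have "real n \<le> 27648 * (real p + 1) * D\<^sup>2 * (s * (real T)\<^sup>2)" by linarith
    then have "c * n \<le> c * (27648 * (real p + 1) * D\<^sup>2 * (s * (real T)\<^sup>2))"
      using c by (intro mult_left_mono) auto
    also have "\<dots> = s * (real T)\<^sup>2" using D by (simp add: c_def)
    finally show ?thesis using T by (simp add: divide_le_eq)
  qed
  moreover have "K \<ge> 1" using K1 by linarith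
  ultimately show "\<exists>(K::nat) (c::real). K \<ge> 1 \<and> c > 0 \<and>
       (\<forall>(n::nat) (T::nat) (s::nat) (R::nat pmf) init step out.
          4 \<le> T \<and> T \<le> n choose 2 \<and> uses_space s init step \<and>
          solves p R init step out (K * n) gamma T
          \<longrightarrow> c * real n / real T ^ 2 \<le> real s)"
    using c by blast
qed

end
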